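(* Let $(W,S)$ be a Coxeter system with $S$ finite and root system $\Phi$. Let $s\in S$ and $x\in W$. (1) If $sx$ is a suffix of $x$, i.e., $sx\lhd x$, then $$N^1(sx)\subseteq s\left(N^1(x)\setminus\{\alpha_s\}\right)\cup f_s\left(N^1(x)\setminus\{\alpha_s\}\right).$$ (2) If $x$ is a suffix of $sx$, i.e., $x\lhd sx$, then $$N^1(sx)=\{\alpha_s\}\sqcup s\left(\{\beta\in N^1(x)\,|\, s_\beta x<ss_\beta x\}\right).$$
   Context: Let $\ell$ be the length function of $(W,S)$. Geometric representation and roots. Fix a geometric representation of $(W,S)$: a real vector space $V$ with a symmetric bilinear form $B$, and a simple system $\Delta=\{\alpha_s : s\in S\}\subseteq V$ (finite, indexed bijectively by $S$) such that: $\sum_{\alpha\in\Delta}a_\alpha\alpha=0$ with all $a_\alpha\ge 0$ implies all $a_\alpha=0$; $B(\alpha,\beta)\in\,]-\infty,-1]\cup\{-\cos(\pi/k): k\in\mathbb N, k\geq 2\}$ for distinct $\alpha,\beta\in\Delta$; $B(\alpha,\alpha)=1$ for $\alpha\in\Delta$; and $W$ is faithfully represented in the group of linear maps preserving $B$, with $s\in S$ acting by $v\mapsto v-2B(\alpha_s,v)\alpha_s$. (So $B(\alpha_s,\alpha_t)=-\cos(\pi/m_{st})$ if the order $m_{st}$ of $st$ is finite, and $B(\alpha_s,\alpha_t)\le -1$ iff $m_{st}=\infty$.) For $A\subseteq V$, $\operatorname{cone}(A)$ is the set of non-negative linear combinations of vectors of $A$. The root system is $\Phi=W(\Delta)$,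 with positive roots $\Phi^+=\operatorname{cone}(\Delta)\cap\Phi$ and negative roots $\Phi^-=-\Phi^+$; $\Phi=\Phi^+\sqcup\Phi^-$. For $\beta\in\Phi$, $s_\beta\in W$ is the reflection $v\mapsto v-2B(\beta,v)\beta$. The (left) inversion set of $w\in W$ is $N(w)=\Phi^+\cap w(\Phi^-)$. Bruhat order. $\leq$ on $W$ is the reflexive transitive closure of the relation: $x\to y$ iff $y=s_\beta x$ for some $\beta\in\Phi^+$ and $\ell(x)<\ell(y)$; $<$ is its strict version. $x\lhd y$ denotes a covering in Bruhat order, i.e. $y=s_\beta x$ for some $\beta\in\Phi^+$ and $\ell(y)=\ell(x)+1$. Base of an inversion set. $N^1(w)$ is the set of $\beta\in\Phi^+$ such that $\mathbb R_{>0}\beta$ is an extreme ray of $\operatorname{cone}(N(w))$. Here an extreme ray of a cone $C$ with $C\cap -C=\{0\}$ is a ray $\mathbb R_{>0}\alpha$ with $\alpha\in C\setminus\{0\}$ such that whenever $\beta,\gamma\in C$ and $\mathbb R_{>0}\alpha\subseteq\operatorname{cone}(\beta,\gamma)$, then $\beta\in\mathbb R_{>0}\alpha$ or $\gamma\in\mathbb R_{>0}\alpha$. The function $f_s$. For $s\in S$, $f_s:\Phi^+\setminus\{\alpha_s\}\to\Phi^+$ sends $\beta$ to the root $f_s(\beta)\in\Phi^+$ determined by $(\mathbb R\alpha_s+\mathbb R\beta)\cap\Phi^+=\operatorname{cone}(\alpha_s,f_s(\beta))\cap\Phi^+$ (i.e. $\{\alpha_s,f_s(\beta)\}$ is the set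 of the two positive roots spanning the extreme rays of the cone generated by the positive roots in the plane spanned by $\alpha_s$ and $\beta$). *)

theory Defs
  imports "HOL-Analysis.Analysis" "HOL-Algebra.Group_Action" "HOL-Algebra.Multiplicative_Group"
begin

section \<open>Coxeter systems\<close>

text \<open>
  The relator for generators \<open>s\<close>, \<open>t\<close> is the word \<open>(s t)\<^sup>m\<close>, where \<open>m\<close> is the order of
  \<open>s \<otimes> t\<close>. An infinite order is \<open>0\<close> in \<open>group.ord\<close>, so that the relator is then the empty
  word and imposes nothing; for \<open>s = t\<close> the relator is \<open>[s, s]\<close>.
\<close>

definition coxeter_relator :: "('w, 'm) monoid_scheme \<Rightarrow> 'w \<Rightarrow> 'w \<Rightarrow> 'w list" where
  "coxeter_relator G s t = concat (replicate (group.ord G (s \<otimes>\<^bsub>G\<^esub> t)) [s, t])"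

definition coxeter_move :: "('w, 'm) monoid_scheme \<Rightarrow> 'w set \<Rightarrow> 'w list \<Rightarrow> 'w list \<Rightarrow> bool" where
  "coxeter_move G S u v \<longleftrightarrow>
     (\<exists>a b s t. set a \<subseteq> S \<and> set b \<subseteq> S \<and> s \<in> S \<and> t \<in> S \<and>
        u = a @ coxeter_relator G s t @ b \<and> v = a @ b)"

definition word_prod :: "('w, 'm) monoid_scheme \<Rightarrow> 'w list \<Rightarrow> 'w" where
  "word_prod G ws = foldr (\<otimes>\<^bsub>G\<^esub>) ws \<one>\<^bsub>G\<^esub>"

text \<open>
  \<open>presentation\<close> says that the relators present \<open>G\<close>. Since \<open>[s, s]\<close> is a relator for every
  generator, words without formal inverses suffice.
\<close>

locale coxeter_system = group G for G (structure) +
  fixes S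
  assumes finite_gens: "finite S"
    and gens_closed: "S \<subseteq> carrier G"
    and gens_nontrivial: "s \<in> S \<Longrightarrow> s \<noteq> \<one>"
    and gens_involution: "s \<in> S \<Longrightarrow> s \<otimes> s = \<one>"
    and generated: "generate G S = carrier G"
    and presentation: "set ws \<subseteq> S \<Longrightarrow> word_prod G ws = \<one> \<Longrightarrow> equivclp (coxeter_move G S) ws []"

definition cox_length :: "('w, 'm) monoid_scheme \<Rightarrow> 'w set \<Rightarrow> 'w \<Rightarrow> nat" where
  "cox_length G S w = (LEAST n. \<exists>ws. set ws \<subseteq> S \<and> length ws = n \<and> word_prod G ws = w)"


section \<open>Geometric representations\<close>

definition reflect :: "('v::real_vector \<Rightarrow> 'v \<Rightarrow> real) \<Rightarrow> 'v \<Rightarrow> 'v \<Rightarrow> 'v" where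
  "reflect B \<beta> v = v - (2 * B \<beta> v) *\<^sub>R \<beta>"

text \<open>
  The simple roots are indexed by the generators: \<open>\<alpha> s\<close> is the simple root of \<open>s\<close>. The action
  of \<open>G\<close> on the whole space is \<open>\<rho>\<close>.
\<close>

locale geometric_representation =
  coxeter_system G S + faithful_action G UNIV \<rho>
  for G :: "('w, 'm) monoid_scheme" (structure) and S and \<rho> :: "'w \<Rightarrow> 'v::real_vector \<Rightarrow> 'v" +
  fixes B :: "'v \<Rightarrow> 'v \<Rightarrow> real" and \<alpha> :: "'w \<Rightarrow> 'v"
  assumes bilinear_form: "bilinear B"
    and symmetric_form: "B u v = B v u"
    and simple_inj: "inj_on \<alpha> S"
    and positively_independent:
      "(\<And>s. s \<in> S \<Longrightarrow> 0 \<le> a s) \<Longrightarrow> (\<Sum>s\<in>S. a s *\<^sub>R \<alpha> s) = 0 \<Longrightarrow> s \<in> S \<Longrightarrow> a s = 0"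
    and simple_form: "s \<in> S \<Longrightarrow> t \<in> S \<Longrightarrow> s \<noteq> t \<Longrightarrow>
      B (\<alpha> s) (\<alpha> t) \<in> {..-1} \<union> {- cos (pi / real k) | k::nat. 2 \<le> k}"
    and simple_norm: "s \<in> S \<Longrightarrow> B (\<alpha> s) (\<alpha> s) = 1"
    and action_linear: "w \<in> carrier G \<Longrightarrow> linear (\<rho> w)"
    and action_form: "w \<in> carrier G \<Longrightarrow> B (\<rho> w u) (\<rho> w v) = B u v"
    and action_simple: "s \<in> S \<Longrightarrow> \<rho> s = reflect B (\<alpha> s)"

definition cone_of :: "'v::real_vector set \<Rightarrow> 'v set" where
  "cone_of A = {\<Sum>v\<in>F. c v *\<^sub>R v | F c. finite F \<and> F \<subseteq> A \<and> (\<forall>v\<in>F. 0 \<le> c v)}"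

lemma cone_of_eq_convex_cone_hull: "cone_of A = convex_cone hull A" for A :: "'v::real_vector set"
proof (rule hull_unique[symmetric])
  show "A \<subseteq> cone_of A"
  proof
    fix v assume "v \<in> A"
    then show "v \<in> cone_of A" unfolding cone_of_def
      by (auto intro!: exI[of _ "{v}"] exI[of _ "\<lambda>_. 1"])
  qed
next
  show "convex_cone (cone_of A)" unfolding convex_cone_iff
  proof (intro conjI ballI allI impI)
    show "0 \<in> cone_of A" unfolding cone_of_def by (auto intro!: exI[of _ "{}"])
  next
    fix x y assume "x \<in> cone_of A" "y \<in> cone_of A"
    then obtain F c F' c' where x: "finite F" "F \<subseteq> A" "\<forall>v\<in>F. 0 \<le> c v" "x = (\<Sum>v\<in>F. c v *\<^sub>R v)"
      and y: "finite F'" "F' \<subseteq> A" "\<forall>v\<in>F'. 0 \<le> c' v" "y = (\<Sum>v\<in>F'. c' v *\<^sub>R v)"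
      unfolding cone_of_def by auto
    have 1: "x = (\<Sum>v\<in>F \<union> F'. (if v \<in> F then c v else 0) *\<^sub>R v)"
      unfolding x using x y by (intro sum.mono_neutral_cong_left) auto
    have 2: "y = (\<Sum>v\<in>F \<union> F'. (if v \<in> F' then c' v else 0) *\<^sub>R v)"
      unfolding y using x y by (intro sum.mono_neutral_cong_left) auto
    have "x + y = (\<Sum>v\<in>F \<union> F'. ((if v \<in> F then c v else 0) + (if v \<in> F' then c' v else 0)) *\<^sub>R v)"
      unfolding 1 2 by (simp add: sum.distrib scaleR_add_left)
    then show "x + y \<in> cone_of A" unfolding cone_of_def using x y
      by (auto intro!: exI[of _ "F \<union> F'"] exI[of _ "\<lambda>v. ((if v \<in> F then c v else 0) + (if v \<in> F' then c' v else 0))"])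
  next
    fix x and k :: real assume "x \<in> cone_of A" "0 \<le> k"
    then obtain F c where x: "finite F" "F \<subseteq> A" "\<forall>v\<in>F. 0 \<le> c v" "x = (\<Sum>v\<in>F. c v *\<^sub>R v)"
      unfolding cone_of_def by auto
    then show "k *\<^sub>R x \<in> cone_of A" unfolding cone_of_def using \<open>0 \<le> k\<close>
      by (auto intro!: exI[of _ "F"] exI[of _ "\<lambda>v. k * c v"] simp: scaleR_sum_right)
  qed
next
  fix T assume "A \<subseteq> T" "convex_cone T"
  have "(\<Sum>v\<in>F. c v *\<^sub>R v) \<in> T" if "finite F" "F \<subseteq> A" "\<forall>v\<in>F. 0 \<le> c v" for F c
    using that \<open>A \<subseteq> T\<close> \<open>convex_cone T\<close>
    by (induction F rule: finite_induct) (auto simp: convex_cone_iff subset_iff)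
  then show "cone_of A \<subseteq> T" unfolding cone_of_def by blast
qed

definition roots ::
  "('w, 'm) monoid_scheme \<Rightarrow> 'w set \<Rightarrow> ('w \<Rightarrow> 'v \<Rightarrow> 'v) \<Rightarrow> ('w \<Rightarrow> 'v::real_vector) \<Rightarrow> 'v set" where
  "roots G S \<rho> \<alpha> = {\<rho> w (\<alpha> s) | w s. w \<in> carrier G \<and> s \<in> S}"

definition pos_roots ::
  "('w, 'm) monoid_scheme \<Rightarrow> 'w set \<Rightarrow> ('w \<Rightarrow> 'v \<Rightarrow> 'v) \<Rightarrow> ('w \<Rightarrow> 'v::real_vector) \<Rightarrow> 'v set" where
  "pos_roots G S \<rho> \<alpha> = cone_of (\<alpha> ` S) \<inter> roots G S \<rho> \<alpha>"

definition neg_roots ::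
  "('w, 'm) monoid_scheme \<Rightarrow> 'w set \<Rightarrow> ('w \<Rightarrow> 'v \<Rightarrow> 'v) \<Rightarrow> ('w \<Rightarrow> 'v::real_vector) \<Rightarrow> 'v set" where
  "neg_roots G S \<rho> \<alpha> = uminus ` pos_roots G S \<rho> \<alpha>"

definition inv_set ::
  "('w, 'm) monoid_scheme \<Rightarrow> 'w set \<Rightarrow> ('w \<Rightarrow> 'v \<Rightarrow> 'v) \<Rightarrow> ('w \<Rightarrow> 'v::real_vector) \<Rightarrow> 'w \<Rightarrow> 'v set" where
  "inv_set G S \<rho> \<alpha> w = pos_roots G S \<rho> \<alpha> \<inter> \<rho> w ` neg_roots G S \<rho> \<alpha>"

text \<open>
  The element of the group acting as the reflection in the root \<open>\<beta>\<close>; it is unique because the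
  action is faithful.
\<close>

definition refl_elt ::
  "('w, 'm) monoid_scheme \<Rightarrow> ('w \<Rightarrow> 'v \<Rightarrow> 'v) \<Rightarrow> ('v::real_vector \<Rightarrow> 'v \<Rightarrow> real) \<Rightarrow> 'v \<Rightarrow> 'w" where
  "refl_elt G \<rho> B \<beta> = (THE w. w \<in> carrier G \<and> \<rho> w = reflect B \<beta>)"


section \<open>Bruhat order\<close>

definition bruhat_step ::
  "('w, 'm) monoid_scheme \<Rightarrow> 'w set \<Rightarrow> ('w \<Rightarrow> 'v \<Rightarrow> 'v) \<Rightarrow> ('v::real_vector \<Rightarrow> 'v \<Rightarrow> real) \<Rightarrow>
    ('w \<Rightarrow> 'v) \<Rightarrow> 'w \<Rightarrow> 'w \<Rightarrow> bool" where
  "bruhat_step G S \<rho> B \<alpha> x y \<longleftrightarrow> x \<in> carrier G \<and>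
     (\<exists>\<beta>\<in>pos_roots G S \<rho> \<alpha>. y = refl_elt G \<rho> B \<beta> \<otimes>\<^bsub>G\<^esub> x) \<and> cox_length G S x < cox_length G S y"

definition bruhat_le ::
  "('w, 'm) monoid_scheme \<Rightarrow> 'w set \<Rightarrow> ('w \<Rightarrow> 'v \<Rightarrow> 'v) \<Rightarrow> ('v::real_vector \<Rightarrow> 'v \<Rightarrow> real) \<Rightarrow>
    ('w \<Rightarrow> 'v) \<Rightarrow> 'w \<Rightarrow> 'w \<Rightarrow> bool" where
  "bruhat_le G S \<rho> B \<alpha> = (bruhat_step G S \<rho> B \<alpha>)\<^sup>*\<^sup>*"

definition bruhat_less ::
  "('w, 'm) monoid_scheme \<Rightarrow> 'w set \<Rightarrow> ('w \<Rightarrow> 'v \<Rightarrow> 'v) \<Rightarrow> ('v::real_vector \<Rightarrow> 'v \<Rightarrow> real) \<Rightarrow>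
    ('w \<Rightarrow> 'v) \<Rightarrow> 'w \<Rightarrow> 'w \<Rightarrow> bool" where
  "bruhat_less G S \<rho> B \<alpha> x y \<longleftrightarrow> bruhat_le G S \<rho> B \<alpha> x y \<and> x \<noteq> y"

definition bruhat_cover ::
  "('w, 'm) monoid_scheme \<Rightarrow> 'w set \<Rightarrow> ('w \<Rightarrow> 'v \<Rightarrow> 'v) \<Rightarrow> ('v::real_vector \<Rightarrow> 'v \<Rightarrow> real) \<Rightarrow>
    ('w \<Rightarrow> 'v) \<Rightarrow> 'w \<Rightarrow> 'w \<Rightarrow> bool" where
  "bruhat_cover G S \<rho> B \<alpha> x y \<longleftrightarrow> x \<in> carrier G \<and>
     (\<exists>\<beta>\<in>pos_roots G S \<rho> \<alpha>. y = refl_elt G \<rho> B \<beta> \<otimes>\<^bsub>G\<^esub> x) \<and> cox_length G S y = cox_length G S x + 1"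


section \<open>Bases of inversion sets\<close>

definition open_ray :: "'v::real_vector \<Rightarrow> 'v set" where
  "open_ray v = {c *\<^sub>R v | c. 0 < c}"

definition extreme_ray :: "'v::real_vector set \<Rightarrow> 'v set \<Rightarrow> bool" where
  "extreme_ray C R \<longleftrightarrow> (\<exists>v\<in>C - {0}. R = open_ray v) \<and>
     (\<forall>\<beta>\<in>C. \<forall>\<gamma>\<in>C. R \<subseteq> cone_of {\<beta>, \<gamma>} \<longrightarrow> \<beta> \<in> R \<or> \<gamma> \<in> R)"

definition inv_base ::
  "('w, 'm) monoid_scheme \<Rightarrow> 'w set \<Rightarrow> ('w \<Rightarrow> 'v \<Rightarrow> 'v) \<Rightarrow> ('w \<Rightarrow> 'v::real_vector) \<Rightarrow> 'w \<Rightarrow> 'v set" where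
  "inv_base G S \<rho> \<alpha> w =
     {\<beta> \<in> pos_roots G S \<rho> \<alpha>. extreme_ray (cone_of (inv_set G S \<rho> \<alpha> w)) (open_ray \<beta>)}"

text \<open>
  \<open>f\<^sub>s\<close>, meaningful on the positive roots other than \<open>\<alpha> s\<close>. Roots have norm one, so the
  defining condition has exactly one solution there.
\<close>

definition second_root ::
  "('w, 'm) monoid_scheme \<Rightarrow> 'w set \<Rightarrow> ('w \<Rightarrow> 'v \<Rightarrow> 'v) \<Rightarrow> ('w \<Rightarrow> 'v::real_vector) \<Rightarrow> 'w \<Rightarrow> 'v \<Rightarrow> 'v" where
  "second_root G S \<rho> \<alpha> s \<beta> =
     (THE \<gamma>. \<gamma> \<in> pos_roots G S \<rho> \<alpha> \<and>
        span {\<alpha> s, \<beta>} \<inter> pos_roots G S \<rho> \<alpha> = cone_of {\<alpha> s, \<gamma>} \<inter> pos_roots G S \<rho> \<alpha>)"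

end

theory Submission
  imports Defs
begin

text \<open>
  Everything rests on a description of the base \<open>N\<^sup>1(w)\<close> by lengths: it consists of the inversions
  \<open>\<beta>\<close> of \<open>w\<close> with \<open>\<ell>(s\<^sub>\<beta> w) = \<ell>(w) - 1\<close> (\<open>mem_inv_base_iff\<close>). Both conditions say that \<open>\<beta>\<close> has no
  obstruction, that is, no other inversion \<open>\<gamma>\<close> of \<open>w\<close> for which \<open>\<delta> = - s\<^sub>\<beta> \<gamma>\<close> is an inversion as
  well. An obstruction gives \<open>\<gamma> + \<delta> = 2 B(\<beta>, \<gamma>) \<beta>\<close>, so \<open>\<beta>\<close> is not extreme. Without
  obstructions, each inversion \<open>\<gamma> \<noteq> \<beta>\<close> has either \<open>s\<^sub>\<beta> \<gamma>\<close> positive or \<open>w\<^sup>-\<^sup>1 s\<^sub>\<beta> \<gamma>\<close> negative. If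
  \<open>\<beta>\<close> were a sum \<open>X\<^sub>1 + X\<^sub>2\<close> of combinations of the two kinds, then \<open>B(\<beta>, X\<^sub>i) \<ge> 1/2\<close> for some \<open>i\<close>, and
  reflecting \<open>X\<^sub>i\<close> subtracts from it at least \<open>\<beta>\<close>. So \<open>s\<^sub>\<beta> X\<^sub>i\<close>, the other summand and a nonnegative
  multiple of \<open>\<beta>\<close> have sum \<open>0\<close>, although all three are positive (\<open>i = 1\<close>) or all three are made negative by \<open>w\<^sup>-\<^sup>1\<close> (\<open>i = 2\<close>)
  (\<open>no_obstruction_imp_extreme\<close>). On the side of lengths, obstructions are exactly what is missing from
  the image of a natural injection of the inversions of \<open>s\<^sub>\<beta> w\<close> into those of \<open>w\<close>, so their
  number is \<open>\<ell>(w) - 1 - \<ell>(s\<^sub>\<beta> w)\<close> (\<open>len_reflection\<close>).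

  Given this, the case \<open>x \<lhd> s x\<close> is a comparison of \<open>s\<^sub>\<beta> x\<close> with \<open>s s\<^sub>\<beta> x = s\<^bsub>s\<beta>\<^esub> s x\<close>
  (\<open>inv_base_ascent\<close>). In the case \<open>y = s x \<lhd> x\<close>, take \<open>\<beta> \<in> N\<^sup>1(y)\<close>. If \<open>s\<^sub>\<beta> y < s s\<^sub>\<beta> y\<close>, then \<open>s \<beta> \<in> N\<^sup>1(x)\<close>.
  Otherwise \<open>s\<^sub>\<beta> \<alpha>\<^sub>s\<close> is an inversion of \<open>y\<close>, and extremality of \<open>\<beta>\<close> then forces \<open>\<alpha>\<^sub>s\<close> and \<open>\<beta>\<close> to
  span the cone of the positive roots in their plane. The element \<open>x\<close> is an alternating product of \<open>s\<close>
  and \<open>s\<^sub>\<beta>\<close>, starting with \<open>s\<close>, times an element without inversions in the plane. Dropping the last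
  factor of the product gives \<open>s\<^sub>\<gamma> x\<close> for a root \<open>\<gamma>\<close> of the plane, and dropping the first two gives \<open>s\<^sub>\<beta> s x\<close>,
  of length \<open>\<ell>(x) - 2\<close>. The former is a longer alternating product than the latter and is
  related to it by a reflection, so \<open>\<ell>(s\<^sub>\<gamma> x) > \<ell>(x) - 2\<close>
  (\<open>dihedral_last_inversion_long\<close>). Hence \<open>\<gamma> \<in> N\<^sup>1(x)\<close> and \<open>f\<^sub>s(\<gamma>) = \<beta>\<close> (\<open>inv_base_descent\<close>).

  The standard facts about roots are derived from the axioms of a geometric representation. The root one is
  that \<open>w\<^sup>-\<^sup>1 \<alpha>\<^sub>s\<close> lies in the cone of the simple roots when \<open>\<ell>(s w) > \<ell>(w)\<close>
  (\<open>simple_root_ascent\<close>); the simple roots may be linearly dependent, so that sign arguments on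
  coefficients are replaced by the fact that the cone of the simple roots is salient and has the simple
  roots on extreme rays.
\<close>

section \<open>Words and the length function\<close>

context coxeter_system
begin

abbreviation len :: "'a \<Rightarrow> nat" where "len \<equiv> cox_length G S"

lemma gen_closed [simp]: "s \<in> S \<Longrightarrow> s \<in> carrier G"
  using gens_closed by blast

lemma gen_cancel [simp]: "s \<in> S \<Longrightarrow> w \<in> carrier G \<Longrightarrow> s \<otimes> (s \<otimes> w) = w"
  by (simp add: gens_involution flip: m_assoc)

lemma inv_gen [simp]: "s \<in> S \<Longrightarrow> inv s = s"
  by (simp add: gens_involution inv_equality)

lemma word_prod_simps [simp]: "word_prod G [] = \<one>" "word_prod G (s # ws) = s \<otimes> word_prod G ws"
  by (simp_all add: word_prod_def)

lemma word_prod_closed [simp]: "set ws \<subseteq> S \<Longrightarrow> word_prod G ws \<in> carrier G"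
  by (induction ws) auto

lemma word_prod_append:
  "set us \<subseteq> S \<Longrightarrow> set vs \<subseteq> S \<Longrightarrow> word_prod G (us @ vs) = word_prod G us \<otimes> word_prod G vs"
  by (induction us) (auto simp: m_assoc)

lemma word_prod_rev: "set ws \<subseteq> S \<Longrightarrow> word_prod G (rev ws) = inv (word_prod G ws)"
  by (induction ws) (auto simp: word_prod_append inv_mult_group)

lemma ex_word:
  assumes "w \<in> carrier G"
  shows "\<exists>ws. set ws \<subseteq> S \<and> word_prod G ws = w"
proof -
  have "w \<in> generate G S" using assms generated by simp
  then show ?thesis
  proof induction
    case one
    show ?case by (intro exI[of _ "[]"]) auto
  next
    case (incl h)
    then show ?case by (intro exI[of _ "[h]"]) auto
  next
    case (inv h)
    then show ?case by (intro exI[of _ "[h]"]) auto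
  next
    case (eng h1 h2)
    then obtain us vs where "set us \<subseteq> S" "word_prod G us = h1" "set vs \<subseteq> S" "word_prod G vs = h2"
      by blast
    then show ?case by (intro exI[of _ "us @ vs"]) (auto simp: word_prod_append)
  qed
qed

lemma ex_reduced_word:
  assumes "w \<in> carrier G"
  shows "\<exists>ws. set ws \<subseteq> S \<and> length ws = len w \<and> word_prod G ws = w"
  unfolding cox_length_def by (rule LeastI_ex) (use ex_word[OF assms] in blast)

lemma len_le: "set ws \<subseteq> S \<Longrightarrow> len (word_prod G ws) \<le> length ws"
  unfolding cox_length_def by (rule Least_le) blast

lemma len_one [simp]: "len \<one> = 0"
  using len_le[of "[]"] by simp

lemma len_eq_0_iff: "w \<in> carrier G \<Longrightarrow> len w = 0 \<longleftrightarrow> w = \<one>"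
  using ex_reduced_word[of w] by auto

lemma len_mult_le:
  assumes "v \<in> carrier G" "w \<in> carrier G"
  shows "len (v \<otimes> w) \<le> len v + len w"
proof -
  obtain us where "set us \<subseteq> S" "length us = len v" "word_prod G us = v"
    using ex_reduced_word assms(1) by blast
  moreover obtain vs where "set vs \<subseteq> S" "length vs = len w" "word_prod G vs = w"
    using ex_reduced_word assms(2) by blast
  ultimately show ?thesis using len_le[of "us @ vs"] by (simp add: word_prod_append)
qed

lemma len_inv:
  assumes "w \<in> carrier G"
  shows "len (inv w) = len w"
proof -
  have "len (inv v) \<le> len v" if v: "v \<in> carrier G" for v
  proof -
    obtain us where "set us \<subseteq> S" "length us = len v" "word_prod G us = v"
      using ex_reduced_word v by blast
    then show ?thesis using len_le[of "rev us"] by (simp add: word_prod_rev)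
  qed
  from this[of w] this[of "inv w"] show ?thesis using assms by simp
qed

text \<open>
  This is where the presentation is used: relators have even length, so a word for \<open>\<one>\<close>
  has even length and \<open>len\<close> changes under multiplication by a generator. The determinant,
  which usually supplies the sign character, is not at hand when the representation is
  infinite-dimensional.
\<close>

lemma even_length_trivial_word:
  assumes "set ws \<subseteq> S" "word_prod G ws = \<one>"
  shows "even (length ws)"
proof -
  have len_relator: "length (concat (replicate n [s, t])) = 2 * n" for n and s t :: 'a
    by (induction n) auto
  have move: "even (length us) = even (length vs)" if "coxeter_move G S us vs" for us vs
    using that unfolding coxeter_move_def coxeter_relator_def by (auto simp: len_relator)
  have "equivclp (coxeter_move G S) ws []" using presentation assms by blast
  then have "even (length ws) = even (length ([] :: 'a list))"
    by (induction rule: equivclp_induct) (use move in auto)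
  then show ?thesis by simp
qed

lemma even_length_word:
  assumes "set us \<subseteq> S" "set vs \<subseteq> S" "word_prod G us = word_prod G vs"
  shows "even (length us) = even (length vs)"
  using even_length_trivial_word[of "us @ rev vs"] assms
  by (simp add: word_prod_append word_prod_rev)

lemma len_gen_mult:
  assumes "s \<in> S" "w \<in> carrier G"
  shows "len (s \<otimes> w) = len w + 1 \<or> len w = len (s \<otimes> w) + 1"
proof -
  obtain us where us: "set us \<subseteq> S" "length us = len w" "word_prod G us = w"
    using ex_reduced_word assms(2) by blast
  obtain vs where vs: "set vs \<subseteq> S" "length vs = len (s \<otimes> w)" "word_prod G vs = s \<otimes> w"
    using ex_reduced_word[of "s \<otimes> w"] assms by auto
  have "len (s \<otimes> w) \<le> len w + 1" using len_le[of "s # us"] us assms by simp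
  moreover have "len w \<le> len (s \<otimes> w) + 1" using len_le[of "s # vs"] vs assms by simp
  moreover have "even (length vs) = even (length (s # us))"
    using us vs assms by (intro even_length_word) auto
  then have "len (s \<otimes> w) \<noteq> len w" using us vs by auto
  ultimately show ?thesis by linarith
qed

lemma ex_left_descent:
  assumes "w \<in> carrier G" "w \<noteq> \<one>"
  shows "\<exists>s\<in>S. len (s \<otimes> w) < len w"
proof -
  obtain ws where ws: "set ws \<subseteq> S" "length ws = len w" "word_prod G ws = w"
    using ex_reduced_word assms by blast
  then obtain s us where su: "ws = s # us"
    using assms len_eq_0_iff[of w] by (cases ws) auto
  have "s \<otimes> w = word_prod G us" using ws su by auto
  then have "len (s \<otimes> w) < len w" using ws(1,2) su len_le[of us] by simp
  then show ?thesis using ws(1) su by auto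
qed

end

section \<open>Alternating products and the coefficients of dihedral roots\<close>

context group
begin

primrec alt_prod :: "'a \<Rightarrow> 'a \<Rightarrow> nat \<Rightarrow> 'a" where
  "alt_prod a b 0 = \<one>"
| "alt_prod a b (Suc n) = alt_prod a b n \<otimes> (if even n then a else b)"

lemma alt_prod_closed [simp]:
  "a \<in> carrier G \<Longrightarrow> b \<in> carrier G \<Longrightarrow> alt_prod a b n \<in> carrier G"
  by (induction n) auto

lemma alt_prod_Suc_left:
  "a \<in> carrier G \<Longrightarrow> b \<in> carrier G \<Longrightarrow> alt_prod a b (Suc n) = a \<otimes> alt_prod b a n"
  by (induction n) (auto simp: m_assoc)

lemma alt_prod_add:
  assumes "a \<in> carrier G" "b \<in> carrier G"
  shows "alt_prod a b (m + n) = alt_prod a b m \<otimes> (if even m then alt_prod a b n else alt_prod b a n)"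
  using assms by (induction n) (auto simp: m_assoc)

lemma inv_alt_prod:
  assumes "a \<in> carrier G" "b \<in> carrier G" "a \<otimes> a = \<one>" "b \<otimes> b = \<one>"
  shows "inv (alt_prod a b n) = (if even n then alt_prod b a n else alt_prod a b n)"
  using assms
proof (induction n arbitrary: a b)
  case (Suc n)
  have "inv a = a" "inv b = b" using Suc.prems by (auto intro: inv_equality)
  then show ?case using Suc alt_prod_Suc_left[of a b n] alt_prod_Suc_left[of b a n]
    by (simp add: inv_mult_group)
qed simp

end

text \<open>
  The polynomial in \<open>c\<close> is the Chebyshev polynomial \<open>U\<^bsub>n-1\<^esub>\<close>. With
  \<open>c = - B(\<alpha>\<^sub>s, \<alpha>\<^sub>t)\<close>, its values are the coefficients of the
  roots of the dihedral group generated by \<open>s\<close> and \<open>t\<close>.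
\<close>

fun dihedral_coeff :: "real \<Rightarrow> nat \<Rightarrow> real" where
  "dihedral_coeff c 0 = 0"
| "dihedral_coeff c (Suc 0) = 1"
| "dihedral_coeff c (Suc (Suc n)) = 2 * c * dihedral_coeff c (Suc n) - dihedral_coeff c n"

lemma dihedral_coeff_nonneg_of_ge_1:
  assumes "c \<ge> 1"
  shows "0 \<le> dihedral_coeff c n"
proof -
  have "0 \<le> dihedral_coeff c n \<and> dihedral_coeff c n \<le> dihedral_coeff c (Suc n)"
  proof (induction n)
    case (Suc n)
    then have "1 * dihedral_coeff c (Suc n) \<le> c * dihedral_coeff c (Suc n)"
      using assms by (intro mult_right_mono) auto
    then show ?case using Suc by simp
  qed simp
  then show ?thesis by simp
qed

lemma dihedral_coeff_cos: "dihedral_coeff (cos x) n * sin x = sin (n * x)"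
proof (induction "cos x" n rule: dihedral_coeff.induct)
  case (3 n)
  have "sin (real (Suc (Suc n)) * x) + sin (n * x) = 2 * cos x * sin (real (Suc n) * x)"
    using sin_add[of "real (Suc n) * x" x] sin_diff[of "real (Suc n) * x" x]
    by (simp add: algebra_simps)
  then show ?case using 3 by (simp add: algebra_simps)
qed simp_all

lemma dihedral_coeff_cos_nonneg:
  fixes k n :: nat
  assumes "2 \<le> k" "n \<le> k"
  shows "0 \<le> dihedral_coeff (cos (pi / k)) n"
proof -
  have pos: "0 < sin (pi / k)"
    using assms by (intro sin_gt_zero) (auto simp: field_simps)
  have "0 \<le> sin (n * (pi / k))"
    using assms by (intro sin_ge_zero) (auto simp: field_simps)
  then have "0 \<le> dihedral_coeff (cos (pi / k)) n * sin (pi / k)" by (simp only: dihedral_coeff_cos)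
  then show ?thesis using pos by (auto simp: zero_le_mult_iff)
qed

lemma dihedral_coeff_cos_period:
  fixes k :: nat
  assumes "2 \<le> k"
  shows "dihedral_coeff (cos (pi / k)) (2 * k) = 0" "dihedral_coeff (cos (pi / k)) (Suc (2 * k)) = 1"
proof -
  have pos: "0 < sin (pi / k)"
    using assms by (intro sin_gt_zero) (auto simp: field_simps)
  have "real (2 * k) * (pi / k) = 2 * pi" using assms by simp
  then have "sin (real (2 * k) * (pi / k)) = 0" by simp
  then show "dihedral_coeff (cos (pi / k)) (2 * k) = 0"
    using dihedral_coeff_cos[of "pi / k" "2 * k"] pos by simp
  have "real (Suc (2 * k)) * (pi / k) = pi / k + 2 * pi" using assms by (simp add: field_simps)
  then have "sin (real (Suc (2 * k)) * (pi / k)) = sin (pi / k)"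
    by (simp only: sin_periodic)
  then show "dihedral_coeff (cos (pi / k)) (Suc (2 * k)) = 1"
    using dihedral_coeff_cos[of "pi / k" "Suc (2 * k)"] pos by simp
qed

section \<open>Cones\<close>

lemma cone_of_zero [simp]: "0 \<in> cone_of A"
  and cone_of_add: "u \<in> cone_of A \<Longrightarrow> v \<in> cone_of A \<Longrightarrow> u + v \<in> cone_of A"
  and cone_of_scale: "0 \<le> c \<Longrightarrow> v \<in> cone_of A \<Longrightarrow> c *\<^sub>R v \<in> cone_of A"
  using convex_cone_convex_cone_hull[of A]
  unfolding cone_of_eq_convex_cone_hull convex_cone_iff by auto

lemma cone_of_incl: "v \<in> A \<Longrightarrow> v \<in> cone_of A"
  unfolding cone_of_eq_convex_cone_hull by (rule hull_inc)

lemma cone_of_minimal: "A \<subseteq> T \<Longrightarrow> convex_cone T \<Longrightarrow> cone_of A \<subseteq> T"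
  unfolding cone_of_eq_convex_cone_hull by (rule hull_minimal)

lemma convex_cone_vimage:
  assumes "linear f"
  shows "convex_cone {u. f u \<in> cone_of A}"
  unfolding convex_cone_iff
  by (auto simp: linear_0[OF assms] linear_add[OF assms] linear_scale[OF assms] intro: cone_of_add cone_of_scale)

lemma convex_cone_inter: "convex_cone T \<Longrightarrow> convex_cone U \<Longrightarrow> convex_cone (T \<inter> U)"
  by (simp add: convex_cone_iff)

lemma cone_of_pair: "u \<in> cone_of {v, w} \<longleftrightarrow> (\<exists>p q. 0 \<le> p \<and> 0 \<le> q \<and> u = p *\<^sub>R v + q *\<^sub>R w)"
proof
  let ?T = "{p *\<^sub>R v + q *\<^sub>R w | p q. 0 \<le> p \<and> 0 \<le> q}"
  have "convex_cone ?T" unfolding convex_cone_iff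
  proof (intro conjI ballI allI impI)
    have "0 = 0 *\<^sub>R v + 0 *\<^sub>R w" by simp
    then show "0 \<in> ?T" by blast
  next
    fix x y assume "x \<in> ?T" "y \<in> ?T"
    then obtain p q p' q' where *: "x = p *\<^sub>R v + q *\<^sub>R w" "y = p' *\<^sub>R v + q' *\<^sub>R w"
      "0 \<le> p" "0 \<le> q" "0 \<le> p'" "0 \<le> q'" by blast
    then have "x + y = (p + p') *\<^sub>R v + (q + q') *\<^sub>R w" by (simp add: algebra_simps)
    then show "x + y \<in> ?T" using * by (metis (mono_tags, lifting) add_nonneg_nonneg mem_Collect_eq)
  next
    fix x and c :: real assume "x \<in> ?T" "0 \<le> c"
    then obtain p q where *: "x = p *\<^sub>R v + q *\<^sub>R w" "0 \<le> p" "0 \<le> q" by blast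
    then have "c *\<^sub>R x = (c * p) *\<^sub>R v + (c * q) *\<^sub>R w" by (simp add: algebra_simps)
    then show "c *\<^sub>R x \<in> ?T" using * \<open>0 \<le> c\<close> by (metis (mono_tags, lifting) mult_nonneg_nonneg mem_Collect_eq)
  qed
  moreover have "v = 1 *\<^sub>R v + 0 *\<^sub>R w" "w = 0 *\<^sub>R v + 1 *\<^sub>R w" by simp_all
  then have "v \<in> ?T" "w \<in> ?T" using zero_le_one by blast+
  ultimately have "cone_of {v, w} \<subseteq> ?T" by (intro cone_of_minimal) auto
  then show "u \<in> cone_of {v, w} \<Longrightarrow> \<exists>p q. 0 \<le> p \<and> 0 \<le> q \<and> u = p *\<^sub>R v + q *\<^sub>R w" by blast
qed (auto intro: cone_of_add cone_of_scale cone_of_incl)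

section \<open>Positivity of the simple roots under ascents\<close>

context coxeter_system
begin

lemma len_alt_prod_le: "s \<in> S \<Longrightarrow> t \<in> S \<Longrightarrow> len (alt_prod s t n) \<le> n"
proof (induction n)
  case (Suc n)
  then have "len (alt_prod s t (Suc n)) \<le> len (alt_prod s t n) + len (if even n then s else t)"
    unfolding alt_prod.simps by (intro len_mult_le) auto
  moreover have "len u \<le> 1" if "u \<in> S" for u
    using that len_le[of "[u]"] by simp
  ultimately show ?case using Suc by fastforce
qed simp

text \<open>
  Beyond \<open>k\<close> letters, an alternating word can be shortened by going around the \<open>2
  k\<close>-gon the other way.
\<close>

lemma len_alt_prod_less:
  assumes st: "s \<in> S" "t \<in> S" and rel: "alt_prod s t (2 * k) = \<one>" and k: "1 \<le> k" "k < n"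
  shows "len (alt_prod s t n) < n"
proof -
  let ?r = "if even (Suc k) then alt_prod s t (k - 1) else alt_prod t s (k - 1)"
  have "alt_prod s t (Suc k + (k - 1)) = alt_prod s t (Suc k) \<otimes> ?r"
    using st by (intro alt_prod_add) auto
  moreover have "Suc k + (k - 1) = 2 * k" using k by simp
  ultimately have "alt_prod s t (Suc k) \<otimes> ?r = \<one>" using rel by (simp only:)
  then have "alt_prod s t (Suc k) = inv ?r"
    using st by (intro inv_equality[symmetric]) (auto simp del: alt_prod.simps)
  then have "len (alt_prod s t (Suc k)) = len ?r" using st by (simp add: len_inv)
  also have "\<dots> \<le> k - 1" using len_alt_prod_le st by auto
  finally have short: "len (alt_prod s t (Suc k)) \<le> k - 1" .
  let ?q = "if even (Suc k) then alt_prod s t (n - Suc k) else alt_prod t s (n - Suc k)"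
  have "alt_prod s t n = alt_prod s t (Suc k) \<otimes> ?q"
    using st alt_prod_add[of s t "Suc k" "n - Suc k"] k by simp
  then have "len (alt_prod s t n) \<le> len (alt_prod s t (Suc k)) + len ?q"
    using len_mult_le[of "alt_prod s t (Suc k)" ?q] st by (simp del: alt_prod.simps)
  moreover have "len ?q \<le> n - Suc k" using len_alt_prod_le st by auto
  ultimately show ?thesis using short k by linarith
qed

end

context geometric_representation
begin

abbreviation simple_cone :: "'v set" where "simple_cone \<equiv> cone_of (\<alpha> ` S)"

lemma form_simps [simp]:
  "B (u + u') v = B u v + B u' v" "B u (v + v') = B u v + B u v'"
  "B (u - u') v = B u v - B u' v" "B u (v - v') = B u v - B u v'"
  "B (- u) v = - B u v" "B u (- v) = - B u v"
  "B (c *\<^sub>R u) v = c * B u v" "B u (c *\<^sub>R v) = c * B u v"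
  "B 0 v = 0" "B u 0 = 0"
  using bilinear_form
  by (simp_all add: bilinear_ladd bilinear_radd bilinear_lsub bilinear_rsub bilinear_lneg
      bilinear_rneg bilinear_lmul bilinear_rmul bilinear_lzero bilinear_rzero)

lemma act_simps [simp]:
  assumes "w \<in> carrier G"
  shows "\<rho> w (u + v) = \<rho> w u + \<rho> w v" "\<rho> w (u - v) = \<rho> w u - \<rho> w v" "\<rho> w (- v) = - \<rho> w v"
    "\<rho> w (c *\<^sub>R v) = c *\<^sub>R \<rho> w v" "\<rho> w 0 = 0"
  using action_linear[OF assms] by (simp_all add: linear_add linear_diff linear_neg linear_scale linear_0)

lemma act_mult: "g \<in> carrier G \<Longrightarrow> h \<in> carrier G \<Longrightarrow> \<rho> (g \<otimes> h) v = \<rho> g (\<rho> h v)"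
  by (rule composition_rule) auto

lemma act_one [simp]: "\<rho> \<one> v = v"
  using id_eq_one by (metis UNIV_I restrict_apply')

lemma act_inv [simp]:
  "g \<in> carrier G \<Longrightarrow> \<rho> (inv g) (\<rho> g v) = v" "g \<in> carrier G \<Longrightarrow> \<rho> g (\<rho> (inv g) v) = v"
  by (simp_all flip: act_mult)

lemma act_eqI: "g \<in> carrier G \<Longrightarrow> h \<in> carrier G \<Longrightarrow> (\<And>v. \<rho> g v = \<rho> h v) \<Longrightarrow> g = h"
  by (rule inj_onD[OF faithful]) auto

lemma act_gen: "s \<in> S \<Longrightarrow> \<rho> s v = v - (2 * B (\<alpha> s) v) *\<^sub>R \<alpha> s"
  by (simp add: action_simple reflect_def)

lemma act_gen_gen [simp]: "s \<in> S \<Longrightarrow> \<rho> s (\<rho> s v) = v"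
  by (metis act_inv(1) gen_closed inv_gen)

lemma act_gen_simple [simp]: "s \<in> S \<Longrightarrow> \<rho> s (\<alpha> s) = - \<alpha> s"
  by (simp add: act_gen simple_norm scaleR_2)

lemma act_alt_prod_simple:
  assumes "s \<in> S" "t \<in> S"
  defines "c \<equiv> - B (\<alpha> s) (\<alpha> t)"
  shows "\<rho> (inv (alt_prod t s n)) (\<alpha> s) =
    (if even n then dihedral_coeff c (Suc n) *\<^sub>R \<alpha> s + dihedral_coeff c n *\<^sub>R \<alpha> t
     else dihedral_coeff c n *\<^sub>R \<alpha> s + dihedral_coeff c (Suc n) *\<^sub>R \<alpha> t)"
proof (induction n)
  case (Suc n)
  have "B (\<alpha> t) (\<alpha> s) = - c" "B (\<alpha> s) (\<alpha> t) = - c" by (simp_all add: c_def symmetric_form)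
  then show ?case using Suc assms(1,2)
    by (simp add: inv_mult_group act_mult act_gen simple_norm algebra_simps scaleR_2)
       (simp add: algebra_simps flip: scaleR_add_left)
qed simp

text \<open>
  The product \<open>(s t)\<^sup>k\<close> fixes both simple roots by periodicity of the sine, and it fixes
  their orthogonal complement; the two span the space because the form is nondegenerate on the plane.
  Faithfulness then gives the relation in the group.
\<close>

lemma dihedral_relation:
  assumes st: "s \<in> S" "t \<in> S" and k: "2 \<le> k" and form: "B (\<alpha> s) (\<alpha> t) = - cos (pi / real k)"
  shows "alt_prod s t (2 * k) = \<one>"
proof (rule act_eqI)
  define g where "g = alt_prod s t (2 * k)"
  define c where "c = cos (pi / real k)"
  have g: "g \<in> carrier G" using st by (simp add: g_def)
  have ginv: "g = inv (alt_prod t s (2 * k))" "inv g = inv (alt_prod s t (2 * k))"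
    using st by (simp_all add: g_def inv_alt_prod gens_involution)
  have fix_s: "\<rho> g (\<alpha> s) = \<alpha> s"
    using act_alt_prod_simple[OF st, of "2 * k"] dihedral_coeff_cos_period[OF k]
    by (simp add: ginv(1) form)
  have "\<rho> (inv g) (\<alpha> t) = \<alpha> t"
    using act_alt_prod_simple[OF st(2,1), of "2 * k"] dihedral_coeff_cos_period[OF k] symmetric_form[of "\<alpha> t"]
    by (simp add: ginv(2) form)
  then have fix_t: "\<rho> g (\<alpha> t) = \<alpha> t" using act_inv(2)[OF g, of "\<alpha> t"] by simp
  fix v
  define d where "d = 1 - c\<^sup>2"
  \<comment> \<open>The projection of \<open>v\<close> to the plane, by Cramers rule; \<open>d\<close> is the Gram
        determinant.\<close>
  define p1 where "p1 = (B (\<alpha> s) v + c * B (\<alpha> t) v) / d"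
  define p2 where "p2 = (B (\<alpha> t) v + c * B (\<alpha> s) v) / d"
  define p where "p = p1 *\<^sub>R \<alpha> s + p2 *\<^sub>R \<alpha> t"
  have "0 < sin (pi / k)"
    using k by (intro sin_gt_zero) (auto simp: field_simps)
  then have "d \<noteq> 0" by (simp add: d_def c_def flip: sin_squared_eq)
  have "p1 - c * p2 = (d * B (\<alpha> s) v) / d" "p2 - c * p1 = (d * B (\<alpha> t) v) / d"
    unfolding p1_def p2_def times_divide_eq_right diff_divide_distrib[symmetric]
    by (simp_all add: d_def algebra_simps power2_eq_square)
  then have "p1 - c * p2 = B (\<alpha> s) v" "p2 - c * p1 = B (\<alpha> t) v" using \<open>d \<noteq> 0\<close> by simp_all
  moreover have "B (\<alpha> s) (\<alpha> t) = - c" "B (\<alpha> t) (\<alpha> s) = - c"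
    using form symmetric_form[of "\<alpha> t"] by (simp_all add: c_def)
  ultimately have "B (\<alpha> s) (v - p) = 0" "B (\<alpha> t) (v - p) = 0"
    using st by (simp_all add: p_def simple_norm algebra_simps)
  then have "\<rho> s (v - p) = v - p" "\<rho> t (v - p) = v - p"
    using st by (simp_all add: act_gen)
  then have "\<rho> (alt_prod s t n) (v - p) = v - p" for n
    using st by (induction n) (simp_all only: alt_prod.simps act_one split: if_splits, auto simp: act_mult simp del: act_simps)
  then have "\<rho> g (v - p) = v - p" by (simp add: g_def)
  moreover have "\<rho> g p = p" using g fix_s fix_t by (simp add: p_def)
  ultimately show "\<rho> (alt_prod s t (2 * k)) v = \<rho> \<one> v" using g by (simp flip: g_def)
qed (use st in auto)

text \<open>
  Let \<open>t\<close> be a left descent of \<open>w\<close>, and strip letters \<open>t, s, t,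
  \<dots>\<close> from the left of \<open>w\<close> as long as this shortens it. What remains,
  \<open>v\<close>, is shorter than \<open>w\<close> and ascends under both \<open>s\<close> and
  \<open>t\<close>, so by induction \<open>v\<^sup>-\<^sup>1\<close> sends both simple roots into the
  cone. The inverse of the stripped word sends \<open>\<alpha>\<^sub>s\<close> to a combination of the
  two whose coefficients are nonnegative as long as the word with \<open>s\<close> put in front of it is
  still reduced.
\<close>

theorem simple_root_ascent:
  assumes "w \<in> carrier G" "s \<in> S" "len w < len (s \<otimes> w)"
  shows "\<rho> (inv w) (\<alpha> s) \<in> simple_cone"
  using assms
proof (induction "len w" arbitrary: w s rule: less_induct)
  case less
  note w = \<open>w \<in> carrier G\<close> and s = \<open>s \<in> S\<close>
  show ?case
  proof (cases "w = \<one>")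
    case True
    then show ?thesis using s by (auto intro: cone_of_incl)
  next
    case False
    then obtain t where t: "t \<in> S" "len (t \<otimes> w) < len w" using ex_left_descent w by blast
    with less.prems have "t \<noteq> s" by auto
    define q where "q n = (if even n then t else s)" for n :: nat
    define x where "x n = inv (alt_prod t s n) \<otimes> w" for n
    have q: "q n \<in> S" for n using s t by (simp add: q_def)
    have x: "x n \<in> carrier G" for n using s t w by (simp add: x_def)
    have x0: "x 0 = w" using w by (simp add: x_def)
    have x_Suc: "x (Suc n) = q n \<otimes> x n" for n
      using s t w by (simp add: x_def q_def inv_mult_group m_assoc)
    have ex: "\<exists>n. len (x n) \<le> len (x (Suc n))"
    proof (rule ccontr)
      assume *: "\<not> ?thesis"
      have "len (x n) + n \<le> len w" for n
      proof (induction n)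
        case (Suc n)
        have "len (x (Suc n)) < len (x n)" using * by (simp add: not_le)
        with Suc show ?case by simp
      qed (simp add: x0)
      from this[of "Suc (len w)"] show False by simp
    qed
    define n where "n = (LEAST n. len (x n) \<le> len (x (Suc n)))"
    have stop: "len (x n) \<le> len (x (Suc n))" unfolding n_def using ex by (rule LeastI_ex)
    have desc: "len (x (Suc i)) < len (x i)" if "i < n" for i
      using not_less_Least[OF that[unfolded n_def]] by simp
    have len_x: "len (x i) + i = len w" if "i \<le> n" for i
      using that
    proof (induction i)
      case (Suc i)
      then show ?case using desc[of i] len_gen_mult[OF q x, of i i] by (simp add: x_Suc)
    qed (simp add: x0)
    have "n \<noteq> 0"
    proof
      assume "n = 0"
      with stop have "len w \<le> len (t \<otimes> w)" using x_Suc[of 0] x0 by (simp add: q_def)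
      with t show False by simp
    qed
    then obtain m where m: "n = Suc m" using not0_implies_Suc by blast
    have up1: "len (x n) < len (q n \<otimes> x n)"
      using stop len_gen_mult[OF q x, of n n] by (auto simp: x_Suc)
    have "q m \<otimes> x n = x m" using x q by (simp add: m x_Suc)
    then have up2: "len (x n) < len (q m \<otimes> x n)" using desc[of m] m by simp
    \<comment> \<open>The last stripped letter ascends by construction, the next one because stripping stops here.\<close>
    have "{q m, q n} = {s, t}" by (auto simp: q_def m)
    then have up: "len (x n) < len (s \<otimes> x n)" "len (x n) < len (t \<otimes> x n)"
      using up1 up2 by (auto simp: doubleton_eq_iff)
    have shorter: "len (x n) < len w" using len_x[of n] \<open>n \<noteq> 0\<close> by simp
    have pos: "\<rho> (inv (x n)) (\<alpha> s) \<in> simple_cone" "\<rho> (inv (x n)) (\<alpha> t) \<in> simple_cone"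
      using less.hyps[OF shorter x] s t up by auto
    have wx: "w = alt_prod t s n \<otimes> x n"
      using s t w unfolding x_def by (simp flip: m_assoc)
    define c where "c = - B (\<alpha> s) (\<alpha> t)"
    have coeff: "0 \<le> dihedral_coeff c n \<and> 0 \<le> dihedral_coeff c (Suc n)"
    proof (cases "c \<ge> 1")
      case True
      then show ?thesis using dihedral_coeff_nonneg_of_ge_1 by blast
    next
      case False
      then obtain k :: nat where k: "2 \<le> k" "c = cos (pi / k)"
        using simple_form[OF s t(1)] \<open>t \<noteq> s\<close> by (auto simp: c_def)
      then have rel: "alt_prod s t (2 * k) = \<one>"
        using s t by (intro dihedral_relation) (auto simp: c_def)
      \<comment> \<open>The word of \<open>n + 1\<close> letters is reduced, hence \<open>n + 1 \<le> k\<close>, within the range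
            where the sine is nonnegative.\<close>
      have "s \<otimes> w = alt_prod s t (Suc n) \<otimes> x n"
        using s t x by (simp add: wx alt_prod_Suc_left m_assoc del: alt_prod.simps)
      then have "len (s \<otimes> w) \<le> len (alt_prod s t (Suc n)) + len (x n)"
        using s t x by (simp add: len_mult_le del: alt_prod.simps)
      then have "Suc n \<le> len (alt_prod s t (Suc n))"
        using len_x[of n] less.prems(3) by linarith
      then have "Suc n \<le> k"
        using len_alt_prod_less[OF s t(1) rel, of "Suc n"] k by (meson leD le_trans not_less one_le_numeral)
      then show ?thesis using dihedral_coeff_cos_nonneg[OF k(1)] k(2) by simp
    qed
    have "\<rho> (inv w) (\<alpha> s) = \<rho> (inv (x n)) (\<rho> (inv (alt_prod t s n)) (\<alpha> s))"
      using s t x by (simp add: wx inv_mult_group act_mult)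
    also have "\<dots> \<in> simple_cone"
      unfolding act_alt_prod_simple[OF s t(1)] using pos coeff x
      by (auto simp: c_def intro!: cone_of_add cone_of_scale)
    finally show ?thesis .
  qed
qed

section \<open>Roots, reflections and inversions\<close>

abbreviation root_system :: "'v set" where "root_system \<equiv> roots G S \<rho> \<alpha>"
abbreviation positive_roots :: "'v set" where "positive_roots \<equiv> pos_roots G S \<rho> \<alpha>"
abbreviation inversions :: "'w \<Rightarrow> 'v set" where "inversions \<equiv> inv_set G S \<rho> \<alpha>"
abbreviation reflection :: "'v \<Rightarrow> 'w" where "reflection \<equiv> refl_elt G \<rho> B"

lemma simple_cone_iff: "u \<in> simple_cone \<longleftrightarrow> (\<exists>a. (\<forall>s\<in>S. 0 \<le> a s) \<and> u = (\<Sum>s\<in>S. a s *\<^sub>R \<alpha> s))"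
proof
  let ?T = "{\<Sum>s\<in>S. a s *\<^sub>R \<alpha> s | a. \<forall>s\<in>S. 0 \<le> a s}"
  have "convex_cone ?T" unfolding convex_cone_iff
  proof (intro conjI ballI allI impI)
    show "0 \<in> ?T" by (auto intro!: exI[of _ "\<lambda>_. 0"])
  next
    fix x y assume "x \<in> ?T" "y \<in> ?T"
    then obtain a b where "x = (\<Sum>s\<in>S. a s *\<^sub>R \<alpha> s)" "y = (\<Sum>s\<in>S. b s *\<^sub>R \<alpha> s)"
      "\<forall>s\<in>S. 0 \<le> a s" "\<forall>s\<in>S. 0 \<le> b s" by blast
    then show "x + y \<in> ?T"
      by (auto intro!: exI[of _ "\<lambda>s. a s + b s"] simp: scaleR_add_left sum.distrib)
  next
    fix x and c :: real assume "x \<in> ?T" "0 \<le> c"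
    then obtain a where "x = (\<Sum>s\<in>S. a s *\<^sub>R \<alpha> s)" "\<forall>s\<in>S. 0 \<le> a s" by blast
    then show "c *\<^sub>R x \<in> ?T"
      using \<open>0 \<le> c\<close> by (auto intro!: exI[of _ "\<lambda>s. c * a s"] simp: scaleR_sum_right)
  qed
  moreover have "\<alpha> s \<in> ?T" if "s \<in> S" for s
    using that finite_gens
    by (auto intro!: exI[of _ "\<lambda>t. if t = s then 1 else 0"] simp: if_distrib[of "\<lambda>c. c *\<^sub>R _"] cong: if_cong)
  ultimately have "simple_cone \<subseteq> ?T" by (intro cone_of_minimal) auto
  then show "u \<in> simple_cone \<Longrightarrow> \<exists>a. (\<forall>s\<in>S. 0 \<le> a s) \<and> u = (\<Sum>s\<in>S. a s *\<^sub>R \<alpha> s)" by blast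
next
  have "(\<Sum>s\<in>T. a s *\<^sub>R \<alpha> s) \<in> simple_cone" if "finite T" "T \<subseteq> S" "\<forall>s\<in>S. 0 \<le> a s" for a T
    using that
    by (induction T rule: finite_induct) (auto intro!: cone_of_add cone_of_scale intro: cone_of_incl)
  then show "\<exists>a. (\<forall>s\<in>S. 0 \<le> a s) \<and> u = (\<Sum>s\<in>S. a s *\<^sub>R \<alpha> s) \<Longrightarrow> u \<in> simple_cone"
    using finite_gens by auto
qed

lemma simple_cone_salient:
  assumes "u \<in> simple_cone" "v \<in> simple_cone" "u + v = 0"
  shows "u = 0" "v = 0"
proof -
  obtain a b where a: "\<forall>s\<in>S. 0 \<le> a s" "u = (\<Sum>s\<in>S. a s *\<^sub>R \<alpha> s)"
    and b: "\<forall>s\<in>S. 0 \<le> b s" "v = (\<Sum>s\<in>S. b s *\<^sub>R \<alpha> s)"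
    using assms(1,2) unfolding simple_cone_iff by blast
  have "(\<Sum>s\<in>S. (a s + b s) *\<^sub>R \<alpha> s) = 0"
    using assms(3) a b by (simp add: scaleR_add_left sum.distrib)
  then have "a s + b s = 0" if "s \<in> S" for s
    using positively_independent[of "\<lambda>s. a s + b s" s] a b that by simp
  then have "a s = 0" if "s \<in> S" for s using a b that by (metis add_nonneg_eq_0_iff)
  then show "u = 0" using a by simp
  then show "v = 0" using assms by simp
qed

lemma simple_cone_salient3:
  assumes "u \<in> simple_cone" "v \<in> simple_cone" "w \<in> simple_cone" "u + v + w = 0"
  shows "u = 0" "v = 0" "w = 0"
proof -
  show w: "w = 0" using simple_cone_salient(2)[of "u + v" w] assms by (simp add: cone_of_add)
  then show "u = 0" "v = 0" using simple_cone_salient[of u v] assms by simp_all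
qed

lemma form_simple_nonpos:
  assumes "s \<in> S" "t \<in> S" "s \<noteq> t"
  shows "B (\<alpha> s) (\<alpha> t) \<le> 0"
proof -
  have "0 \<le> cos (pi / real k)" if "2 \<le> k" for k :: nat
    using that by (intro cos_ge_zero) (auto simp: field_simps intro: order_trans[of _ 0])
  then show ?thesis using simple_form[OF assms] by auto
qed

text \<open>
  A substitute for linear independence of the simple roots. Pairing with \<open>\<alpha>\<^sub>s\<close>
  shows that \<open>\<alpha>\<^sub>s\<close> is not a nonnegative combination of the other simple roots,
  because these have nonpositive product with it.
\<close>

lemma simple_root_extreme:
  assumes s: "s \<in> S" and uv: "u \<in> simple_cone" "v \<in> simple_cone" "u + v = c *\<^sub>R \<alpha> s"
  shows "\<exists>d\<ge>0. u = d *\<^sub>R \<alpha> s"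
proof -
  obtain a b where a: "\<forall>r\<in>S. 0 \<le> a r" "u = (\<Sum>r\<in>S. a r *\<^sub>R \<alpha> r)"
    and b: "\<forall>r\<in>S. 0 \<le> b r" "v = (\<Sum>r\<in>S. b r *\<^sub>R \<alpha> r)"
    using uv(1,2) unfolding simple_cone_iff by blast
  have rest: "(\<Sum>r\<in>S - {s}. (a r + b r) *\<^sub>R \<alpha> r) = (c - a s - b s) *\<^sub>R \<alpha> s"
    using uv(3) s finite_gens unfolding a b
    by (simp add: sum.remove[of S s] scaleR_add_left sum.distrib algebra_simps)
  have "c - a s - b s \<le> 0"
  proof -
    have lin: "B (\<alpha> s) (\<Sum>r\<in>T. f r *\<^sub>R \<alpha> r) = (\<Sum>r\<in>T. f r * B (\<alpha> s) (\<alpha> r))" if "finite T" for f T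
      using that by (induction T rule: finite_induct) auto
    have "c - a s - b s = B (\<alpha> s) (\<Sum>r\<in>S - {s}. (a r + b r) *\<^sub>R \<alpha> r)"
      using s by (simp add: rest simple_norm)
    also have "\<dots> \<le> 0"
      unfolding lin[OF finite_Diff[OF finite_gens]]
      using a b s form_simple_nonpos by (intro sum_nonpos mult_nonneg_nonpos) auto
    finally show ?thesis .
  qed
  \<comment> \<open>So the coefficient of \<open>\<alpha> s\<close> can be moved to the other side without becoming negative.\<close>
  moreover have "(\<Sum>r\<in>S. (if r = s then a s + b s - c else a r + b r) *\<^sub>R \<alpha> r) = 0"
  proof -
    have "(\<Sum>r\<in>S - {s}. (if r = s then a s + b s - c else a r + b r) *\<^sub>R \<alpha> r) =
        (\<Sum>r\<in>S - {s}. (a r + b r) *\<^sub>R \<alpha> r)"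
      by (intro sum.cong) auto
    then show ?thesis
      unfolding sum.remove[OF finite_gens s] rest by (simp add: algebra_simps)
  qed
  ultimately have "(if r = s then a s + b s - c else a r + b r) = 0" if "r \<in> S" for r
    using positively_independent[of "\<lambda>r. if r = s then a s + b s - c else a r + b r" r] a b that by auto
  then have "a r = 0" if "r \<in> S" "r \<noteq> s" for r
    using that a b by (metis add_nonneg_eq_0_iff)
  then have "(\<Sum>r\<in>S - {s}. a r *\<^sub>R \<alpha> r) = 0" by (intro sum.neutral) auto
  then have "u = a s *\<^sub>R \<alpha> s" unfolding a sum.remove[OF finite_gens s] by simp
  then show ?thesis using a s by blast
qed

lemma root_act:
  assumes "\<beta> \<in> root_system" "w \<in> carrier G"
  shows "\<rho> w \<beta> \<in> root_system"
proof -
  obtain v s where "v \<in> carrier G" "s \<in> S" "\<beta> = \<rho> v (\<alpha> s)"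
    using assms(1) unfolding roots_def by blast
  then have "\<rho> w \<beta> = \<rho> (w \<otimes> v) (\<alpha> s)" "w \<otimes> v \<in> carrier G"
    using assms(2) by (simp_all add: act_mult)
  then show ?thesis using \<open>s \<in> S\<close> unfolding roots_def by blast
qed

lemma root_norm: "\<beta> \<in> root_system \<Longrightarrow> B \<beta> \<beta> = 1"
  unfolding roots_def by (auto simp: action_form simple_norm)

lemma root_neg:
  assumes "\<beta> \<in> root_system"
  shows "- \<beta> \<in> root_system"
proof -
  obtain w s where "w \<in> carrier G" "s \<in> S" "\<beta> = \<rho> w (\<alpha> s)"
    using assms unfolding roots_def by blast
  then have "- \<beta> = \<rho> (w \<otimes> s) (\<alpha> s)" "w \<otimes> s \<in> carrier G" by (simp_all add: act_mult)
  then show ?thesis using \<open>s \<in> S\<close> unfolding roots_def by blast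
qed

lemma simple_positive:
  assumes "s \<in> S"
  shows "\<alpha> s \<in> positive_roots"
proof -
  have "\<alpha> s = \<rho> \<one> (\<alpha> s)" by simp
  then have "\<alpha> s \<in> root_system" using assms unfolding roots_def by blast
  then show ?thesis using assms by (auto simp: pos_roots_def intro: cone_of_incl)
qed

lemma positive_root: "\<beta> \<in> positive_roots \<Longrightarrow> \<beta> \<in> root_system"
  and positive_cone: "\<beta> \<in> positive_roots \<Longrightarrow> \<beta> \<in> simple_cone"
  by (auto simp: pos_roots_def)

lemma positiveI: "\<beta> \<in> root_system \<Longrightarrow> \<beta> \<in> simple_cone \<Longrightarrow> \<beta> \<in> positive_roots"
  by (auto simp: pos_roots_def)

lemma act_positiveI:
  "\<beta> \<in> positive_roots \<Longrightarrow> w \<in> carrier G \<Longrightarrow> \<rho> w \<beta> \<in> simple_cone \<Longrightarrow> \<rho> w \<beta> \<in> positive_roots"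
  by (simp add: positiveI positive_root root_act)

lemma positive_norm: "\<beta> \<in> positive_roots \<Longrightarrow> B \<beta> \<beta> = 1"
  by (simp add: positive_root root_norm)

lemma positive_nonzero: "\<beta> \<in> positive_roots \<Longrightarrow> \<beta> \<noteq> 0"
  using positive_norm by force

lemma not_positive_neg: "\<beta> \<in> positive_roots \<Longrightarrow> - \<beta> \<notin> positive_roots"
  using simple_cone_salient(1)[of \<beta> "- \<beta>"] positive_nonzero positive_cone by auto

theorem root_positive_or_negative:
  assumes "\<beta> \<in> root_system"
  shows "\<beta> \<in> positive_roots \<or> - \<beta> \<in> positive_roots"
proof -
  obtain w s where ws: "w \<in> carrier G" "s \<in> S" "\<beta> = \<rho> w (\<alpha> s)"
    using assms unfolding roots_def by blast
  from len_gen_mult[OF ws(2), of "inv w"] ws(1)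
  consider "len (inv w) < len (s \<otimes> inv w)" | "len (s \<otimes> inv w) < len (s \<otimes> (s \<otimes> inv w))"
    using ws by fastforce
  then have "\<beta> \<in> simple_cone \<or> - \<beta> \<in> simple_cone"
  proof cases
    case 1
    then show ?thesis using simple_root_ascent[of "inv w" s] ws by simp
  next
    case 2
    then have "\<rho> (inv (s \<otimes> inv w)) (\<alpha> s) \<in> simple_cone"
      using simple_root_ascent[of "s \<otimes> inv w" s] ws by simp
    then show ?thesis using ws by (simp add: inv_mult_group act_mult)
  qed
  then show ?thesis using assms root_neg by (auto intro: positiveI)
qed

lemma positive_proportional_eq:
  assumes "\<beta> \<in> positive_roots" "\<gamma> \<in> positive_roots" "\<beta> = c *\<^sub>R \<gamma>"
  shows "\<beta> = \<gamma>"
proof -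
  have "c * c = 1" using positive_norm[OF assms(1)] positive_norm[OF assms(2)] assms(3) by simp
  then have "c = 1 \<or> c = - 1" by (metis power2_eq_1_iff power2_eq_square)
  moreover have "c \<noteq> - 1" using assms not_positive_neg[of \<beta>] by auto
  ultimately show ?thesis using assms by simp
qed

lemma gen_permutes_positive:
  assumes "s \<in> S" "\<beta> \<in> positive_roots" "\<beta> \<noteq> \<alpha> s"
  shows "\<rho> s \<beta> \<in> positive_roots"
proof (rule ccontr)
  assume "\<rho> s \<beta> \<notin> positive_roots"
  then have neg: "- \<rho> s \<beta> \<in> positive_roots"
    using root_positive_or_negative[of "\<rho> s \<beta>"] root_act positive_root assms by auto
  have "\<beta> + (- \<rho> s \<beta>) = (2 * B (\<alpha> s) \<beta>) *\<^sub>R \<alpha> s"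
    using assms by (simp add: act_gen)
  then obtain d where "\<beta> = d *\<^sub>R \<alpha> s"
    using simple_root_extreme[OF assms(1)] neg assms positive_cone by blast
  then show False using positive_proportional_eq assms simple_positive by blast
qed

lemma refl_unique: "g \<in> carrier G \<Longrightarrow> (\<And>v. \<rho> g v = reflect B \<beta> v) \<Longrightarrow> reflection \<beta> = g"
  unfolding refl_elt_def by (rule the_equality) (auto intro!: act_eqI)

lemma refl_root:
  assumes "w \<in> carrier G" "s \<in> S"
  shows "reflection (\<rho> w (\<alpha> s)) = w \<otimes> s \<otimes> inv w"
proof (rule refl_unique)
  fix v
  have "B (\<alpha> s) (\<rho> (inv w) v) = B (\<rho> w (\<alpha> s)) v"
    using action_form[of w "\<alpha> s" "\<rho> (inv w) v"] assms by simp
  then show "\<rho> (w \<otimes> s \<otimes> inv w) v = reflect B (\<rho> w (\<alpha> s)) v"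
    using assms by (simp add: act_mult act_gen reflect_def)
qed (use assms in auto)

lemma refl_closed [simp]: "\<beta> \<in> root_system \<Longrightarrow> reflection \<beta> \<in> carrier G"
  and act_refl: "\<beta> \<in> root_system \<Longrightarrow> \<rho> (reflection \<beta>) v = v - (2 * B \<beta> v) *\<^sub>R \<beta>"
proof -
  assume "\<beta> \<in> root_system"
  then obtain w s where ws: "w \<in> carrier G" "s \<in> S" "\<beta> = \<rho> w (\<alpha> s)"
    unfolding roots_def by blast
  then show "reflection \<beta> \<in> carrier G" by (simp add: refl_root)
  have "B (\<alpha> s) (\<rho> (inv w) v) = B \<beta> v"
    using action_form[of w "\<alpha> s" "\<rho> (inv w) v"] ws by simp
  then show "\<rho> (reflection \<beta>) v = v - (2 * B \<beta> v) *\<^sub>R \<beta>"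
    using ws by (simp add: refl_root act_mult act_gen)
qed

lemma refl_simple: "s \<in> S \<Longrightarrow> reflection (\<alpha> s) = s"
  using refl_root[of \<one> s] by simp

lemma act_refl_self: "\<beta> \<in> root_system \<Longrightarrow> \<rho> (reflection \<beta>) \<beta> = - \<beta>"
  by (simp add: act_refl root_norm scaleR_2)

lemma refl_involution [simp]:
  assumes "\<beta> \<in> root_system"
  shows "reflection \<beta> \<otimes> reflection \<beta> = \<one>"
  using assms by (intro act_eqI) (auto simp: act_mult act_refl root_norm algebra_simps scaleR_2)

lemma inv_refl [simp]: "\<beta> \<in> root_system \<Longrightarrow> inv (reflection \<beta>) = reflection \<beta>"
  by (intro inv_equality) auto

lemma refl_refl [simp]:
  "\<beta> \<in> root_system \<Longrightarrow> w \<in> carrier G \<Longrightarrow> reflection \<beta> \<otimes> (reflection \<beta> \<otimes> w) = w"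
  by (simp flip: m_assoc)

lemma act_refl_refl [simp]: "\<beta> \<in> root_system \<Longrightarrow> \<rho> (reflection \<beta>) (\<rho> (reflection \<beta>) v) = v"
  by (simp flip: act_mult)

lemma refl_conj:
  assumes "\<beta> \<in> root_system" "w \<in> carrier G"
  shows "reflection (\<rho> w \<beta>) = w \<otimes> reflection \<beta> \<otimes> inv w"
proof (rule refl_unique)
  fix v
  have "B \<beta> (\<rho> (inv w) v) = B (\<rho> w \<beta>) v"
    using action_form[of w \<beta> "\<rho> (inv w) v"] assms by simp
  then show "\<rho> (w \<otimes> reflection \<beta> \<otimes> inv w) v = reflect B (\<rho> w \<beta>) v"
    using assms by (simp add: act_mult act_refl reflect_def)
qed (use assms in auto)

lemma mem_inversions:
  assumes "w \<in> carrier G"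
  shows "\<beta> \<in> inversions w \<longleftrightarrow> \<beta> \<in> positive_roots \<and> - \<rho> (inv w) \<beta> \<in> positive_roots"
proof
  assume "\<beta> \<in> inversions w"
  then show "\<beta> \<in> positive_roots \<and> - \<rho> (inv w) \<beta> \<in> positive_roots"
    using assms by (auto simp: inv_set_def neg_roots_def)
next
  assume *: "\<beta> \<in> positive_roots \<and> - \<rho> (inv w) \<beta> \<in> positive_roots"
  then have "\<beta> = \<rho> w (- (- \<rho> (inv w) \<beta>))" using assms by simp
  then show "\<beta> \<in> inversions w" using * unfolding inv_set_def neg_roots_def by blast
qed

lemma not_mem_inversions:
  assumes "w \<in> carrier G" "\<beta> \<in> positive_roots"
  shows "\<beta> \<notin> inversions w \<longleftrightarrow> \<rho> (inv w) \<beta> \<in> positive_roots"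
  using root_positive_or_negative[of "\<rho> (inv w) \<beta>"] root_act positive_root assms not_positive_neg
  by (auto simp: mem_inversions)

lemma simple_not_inversion:
  assumes "w \<in> carrier G" "s \<in> S"
  shows "\<alpha> s \<notin> inversions w \<longleftrightarrow> len w < len (s \<otimes> w)"
proof
  assume "len w < len (s \<otimes> w)"
  then have "\<rho> (inv w) (\<alpha> s) \<in> positive_roots"
    using simple_root_ascent assms simple_positive by (blast intro: act_positiveI inv_closed)
  then show "\<alpha> s \<notin> inversions w"
    using assms simple_positive by (simp add: not_mem_inversions)
next
  assume notin: "\<alpha> s \<notin> inversions w"
  show "len w < len (s \<otimes> w)"
  proof (rule ccontr)
    assume "\<not> ?thesis"
    then have "len (s \<otimes> w) < len (s \<otimes> (s \<otimes> w))" using len_gen_mult[of s w] assms by auto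
    then have "\<rho> (inv (s \<otimes> w)) (\<alpha> s) \<in> positive_roots"
      using simple_root_ascent[of "s \<otimes> w" s] assms simple_positive
      by (simp add: act_positiveI)
    then have "- \<rho> (inv w) (\<alpha> s) \<in> positive_roots" using assms by (simp add: inv_mult_group act_mult)
    then show False using notin assms simple_positive by (simp add: mem_inversions)
  qed
qed

lemma simple_inversion:
  assumes "w \<in> carrier G" "s \<in> S"
  shows "\<alpha> s \<in> inversions w \<longleftrightarrow> len w = len (s \<otimes> w) + 1"
  using simple_not_inversion[OF assms] len_gen_mult[OF assms(2,1)] by linarith

lemma inversions_gen_mult:
  assumes w: "w \<in> carrier G" and s: "s \<in> S" and up: "len w < len (s \<otimes> w)"
  shows "inversions (s \<otimes> w) = insert (\<alpha> s) (\<rho> s ` inversions w)"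
proof (intro equalityI subsetI)
  have notin: "\<alpha> s \<notin> inversions w" using assms simple_not_inversion by blast
  fix \<beta>
  {
    assume \<beta>: "\<beta> \<in> inversions (s \<otimes> w)"
    show "\<beta> \<in> insert (\<alpha> s) (\<rho> s ` inversions w)"
    proof (cases "\<beta> = \<alpha> s")
      case False
      have "\<rho> s \<beta> \<in> inversions w"
        using \<beta> w s gen_permutes_positive[OF s _ False]
        by (simp add: mem_inversions inv_mult_group act_mult)
      then show ?thesis using s by (metis act_gen_gen imageI insertI2)
    qed simp
  next
    assume "\<beta> \<in> insert (\<alpha> s) (\<rho> s ` inversions w)"
    then consider "\<beta> = \<alpha> s" | \<gamma> where "\<gamma> \<in> inversions w" "\<beta> = \<rho> s \<gamma>" by blast
    then show "\<beta> \<in> inversions (s \<otimes> w)"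
    proof cases
      case 1
      then show ?thesis using up w s not_mem_inversions[of w "\<alpha> s"] notin simple_positive
        by (simp add: mem_inversions inv_mult_group act_mult)
    next
      case 2
      then show ?thesis using w s notin gen_permutes_positive[OF s, of \<gamma>]
        by (auto simp: mem_inversions inv_mult_group act_mult)
    qed
  }
qed

lemma simple_root_not_image:
  assumes "s \<in> S" "x \<in> carrier G"
  shows "\<alpha> s \<notin> \<rho> s ` inversions x"
proof
  assume "\<alpha> s \<in> \<rho> s ` inversions x"
  then obtain \<gamma> where \<gamma>: "\<gamma> \<in> inversions x" "\<alpha> s = \<rho> s \<gamma>" by blast
  then have "\<gamma> = - \<alpha> s" using assms by (metis act_gen_gen act_gen_simple)
  then show False using \<gamma>(1) assms simple_positive not_positive_neg by (auto simp: mem_inversions)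
qed

text \<open>
  Each ascent adds one inversion, namely the simple root of the generator.
\<close>

theorem card_inversions:
  assumes "w \<in> carrier G"
  shows "finite (inversions w) \<and> card (inversions w) = len w"
  using assms
proof (induction "len w" arbitrary: w rule: less_induct)
  case less
  show ?case
  proof (cases "w = \<one>")
    case True
    have "inversions \<one> = {}" using not_positive_neg by (auto simp: mem_inversions)
    then show ?thesis using True by simp
  next
    case False
    then obtain s where s: "s \<in> S" "len (s \<otimes> w) < len w" using ex_left_descent less.prems by blast
    have IH: "finite (inversions (s \<otimes> w))" "card (inversions (s \<otimes> w)) = len (s \<otimes> w)"
      using less.hyps[OF s(2)] less.prems s by auto
    have eq: "inversions w = insert (\<alpha> s) (\<rho> s ` inversions (s \<otimes> w))"
      using inversions_gen_mult[of "s \<otimes> w" s] less.prems s by simp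
    have "\<alpha> s \<notin> \<rho> s ` inversions (s \<otimes> w)"
      using simple_root_not_image s less.prems by simp
    moreover have "inj_on (\<rho> s) (inversions (s \<otimes> w))"
      using s by (metis act_gen_gen inj_onI)
    ultimately have "card (inversions w) = Suc (len (s \<otimes> w))"
      using IH by (simp add: eq card_image)
    then show ?thesis using IH eq s len_gen_mult[of s w] less.prems by auto
  qed
qed

section \<open>Inversions of a reflected element\<close>

text \<open>
  These come in pairs \<open>\<gamma>\<close>, \<open>- s\<^sub>\<beta> \<gamma>\<close> that have a
  positive multiple of \<open>\<beta>\<close> as their sum.
\<close>

definition obstructions :: "'w \<Rightarrow> 'v \<Rightarrow> 'v set" where
  "obstructions w \<beta> =
     {\<gamma> \<in> inversions w - {\<beta>}. - \<rho> (reflection \<beta>) \<gamma> \<in> inversions w}"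

lemma reflected_pair:
  assumes "\<beta> \<in> positive_roots" "\<gamma> \<in> positive_roots" "- \<rho> (reflection \<beta>) \<gamma> \<in> positive_roots"
  shows "\<gamma> + (- \<rho> (reflection \<beta>) \<gamma>) = (2 * B \<beta> \<gamma>) *\<^sub>R \<beta>" "0 < B \<beta> \<gamma>"
proof -
  show sum: "\<gamma> + (- \<rho> (reflection \<beta>) \<gamma>) = (2 * B \<beta> \<gamma>) *\<^sub>R \<beta>"
    using assms by (simp add: act_refl positive_root)
  show "0 < B \<beta> \<gamma>"
  proof (rule ccontr)
    assume "\<not> ?thesis"
    then have "(- (2 * B \<beta> \<gamma>)) *\<^sub>R \<beta> \<in> simple_cone"
      using assms by (intro cone_of_scale) (auto simp: positive_cone)
    moreover have "\<gamma> + (- \<rho> (reflection \<beta>) \<gamma>) + (- (2 * B \<beta> \<gamma>)) *\<^sub>R \<beta> = 0" unfolding sum by simp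
    ultimately have "\<gamma> = 0" using simple_cone_salient3(1) assms positive_cone by blast
    then show False using assms positive_nonzero by blast
  qed
qed

text \<open>
  The map reflects an inversion when the result is positive and keeps it otherwise. If
  \<open>s\<^sub>\<beta> \<delta>\<close> is negative, \<open>\<delta>\<close> stays an inversion of
  \<open>w\<close> because \<open>w\<^sup>-\<^sup>1\<close> is negative on \<open>\<beta>\<close> and
  positive on \<open>- s\<^sub>\<beta> \<delta>\<close>. An inversion \<open>\<gamma> \<noteq>
  \<beta>\<close> of \<open>w\<close> is missed exactly when neither \<open>s\<^sub>\<beta>
  \<gamma>\<close> nor \<open>\<gamma>\<close> is an inversion of \<open>s\<^sub>\<beta> w\<close>, which
  is to say that \<open>- s\<^sub>\<beta> \<gamma>\<close> is an inversion of \<open>w\<close>.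
\<close>

lemma bij_betw_inversions_reflection:
  assumes w: "w \<in> carrier G" and \<beta>: "\<beta> \<in> inversions w"
  shows "bij_betw (\<lambda>\<delta>. if \<rho> (reflection \<beta>) \<delta> \<in> positive_roots then \<rho> (reflection \<beta>) \<delta> else \<delta>)
    (inversions (reflection \<beta> \<otimes> w)) (inversions w - {\<beta>} - obstructions w \<beta>)"
    (is "bij_betw ?f (inversions ?v) ?T")
proof -
  define r where "r = \<rho> (reflection \<beta>)"
  have \<beta>pos: "\<beta> \<in> positive_roots" and \<beta>neg: "- \<rho> (inv w) \<beta> \<in> positive_roots"
    using \<beta> w by (auto simp: mem_inversions)
  have \<beta>root: "\<beta> \<in> root_system" using \<beta>pos positive_root by blast
  have v: "?v \<in> carrier G" using w \<beta>root by simp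
  have rr: "r (r u) = u" for u using \<beta>root by (simp add: r_def)
  have r\<beta>: "r \<beta> = - \<beta>" using \<beta>root by (simp add: r_def act_refl_self)
  have r_neg: "r (- u) = - r u" for u using \<beta>root by (simp add: r_def)
  have r_pos: "- r u \<in> positive_roots" if "u \<in> positive_roots" "r u \<notin> positive_roots" for u
    using that root_positive_or_negative[of "r u"] \<beta>root root_act positive_root by (simp add: r_def)
  have mem_v: "\<delta> \<in> inversions ?v \<longleftrightarrow> \<delta> \<in> positive_roots \<and> - \<rho> (inv w) (r \<delta>) \<in> positive_roots" for \<delta>
    using v w \<beta>root by (simp add: mem_inversions inv_mult_group act_mult r_def)
  have mem_w: "\<delta> \<in> inversions w \<longleftrightarrow> \<delta> \<in> positive_roots \<and> - \<rho> (inv w) \<delta> \<in> positive_roots" for \<delta>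
    using w by (rule mem_inversions)
  have f: "?f = (\<lambda>\<delta>. if r \<delta> \<in> positive_roots then r \<delta> else \<delta>)" unfolding r_def by (rule refl)
  show ?thesis unfolding f
  proof (rule bij_betw_imageI)
    show "inj_on (\<lambda>\<delta>. if r \<delta> \<in> positive_roots then r \<delta> else \<delta>) (inversions ?v)"
    proof (rule inj_onI)
      fix x y assume xy: "x \<in> inversions ?v" "y \<in> inversions ?v"
        "(if r x \<in> positive_roots then r x else x) = (if r y \<in> positive_roots then r y else y)"
      then show "x = y" using rr by (metis mem_v)
    qed
    show "(\<lambda>\<delta>. if r \<delta> \<in> positive_roots then r \<delta> else \<delta>) ` inversions ?v = ?T"
    proof (intro equalityI subsetI)
      fix \<gamma> assume "\<gamma> \<in> (\<lambda>\<delta>. if r \<delta> \<in> positive_roots then r \<delta> else \<delta>) ` inversions ?v"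
      then obtain \<delta> where \<delta>: "\<delta> \<in> positive_roots" "- \<rho> (inv w) (r \<delta>) \<in> positive_roots"
        and \<gamma>: "\<gamma> = (if r \<delta> \<in> positive_roots then r \<delta> else \<delta>)"
        using mem_v by blast
      show "\<gamma> \<in> ?T"
      proof (cases "r \<delta> \<in> positive_roots")
        case True
        have "r \<delta> \<noteq> \<beta>" using rr[of \<delta>] r\<beta> \<delta>(1) not_positive_neg[OF \<beta>pos] by metis
        then show ?thesis using True \<gamma> \<delta> rr not_positive_neg
          by (auto simp: mem_w obstructions_def simp flip: r_def)
      next
        case False
        then have neg: "- r \<delta> \<in> positive_roots" using \<delta> r_pos by blast
        note pair = reflected_pair[OF \<beta>pos \<delta>(1), folded r_def, OF neg]
        have "\<delta> = (2 * B \<beta> \<delta>) *\<^sub>R \<beta> + r \<delta>" using pair(1) by (simp add: algebra_simps)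
        then have "\<rho> (inv w) \<delta> = (2 * B \<beta> \<delta>) *\<^sub>R \<rho> (inv w) \<beta> + \<rho> (inv w) (r \<delta>)"
          using w by (metis act_simps(1,4) inv_closed)
        then have "- \<rho> (inv w) \<delta> = (2 * B \<beta> \<delta>) *\<^sub>R (- \<rho> (inv w) \<beta>) + (- \<rho> (inv w) (r \<delta>))" by simp
        also have "\<dots> \<in> simple_cone"
          using pair(2) \<delta> \<beta>neg by (intro cone_of_add cone_of_scale) (auto simp: positive_cone)
        finally have "- \<rho> (inv w) \<delta> \<in> simple_cone" .
        then have "- \<rho> (inv w) \<delta> \<in> positive_roots"
          using act_positiveI[OF _ inv_closed[OF w]] \<delta>(1) positive_root positiveI root_neg root_act w
          by (meson inv_closed)
        moreover have "\<delta> \<noteq> \<beta>" using \<delta>(2) r\<beta> \<beta>neg not_positive_neg w by auto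
        moreover have "- r \<delta> \<notin> inversions w" using \<delta>(2) not_positive_neg w by (auto simp: mem_w)
        ultimately show ?thesis using False \<gamma> \<delta>(1) by (simp add: mem_w obstructions_def flip: r_def)
      qed
    next
      fix \<gamma> assume "\<gamma> \<in> ?T"
      then have \<gamma>: "\<gamma> \<in> positive_roots" "- \<rho> (inv w) \<gamma> \<in> positive_roots" "- r \<gamma> \<notin> inversions w"
        by (auto simp: mem_w obstructions_def r_def)
      show "\<gamma> \<in> (\<lambda>\<delta>. if r \<delta> \<in> positive_roots then r \<delta> else \<delta>) ` inversions ?v"
      proof (cases "r \<gamma> \<in> positive_roots")
        case True
        then show ?thesis using \<gamma> by (intro image_eqI[of _ _ "r \<gamma>"]) (auto simp: rr mem_v)
      next
        case False
        then have "- r \<gamma> \<in> positive_roots" using \<gamma> r_pos by blast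
        then have "- \<rho> (inv w) (r \<gamma>) \<in> positive_roots"
          using \<gamma>(3) not_mem_inversions[OF w, of "- r \<gamma>"] w by simp
        then show ?thesis using \<gamma> False by (intro image_eqI[of _ _ \<gamma>]) (auto simp: mem_v)
      qed
    qed
  qed
qed

theorem len_reflection:
  assumes w: "w \<in> carrier G" and \<beta>: "\<beta> \<in> inversions w"
  shows "len (reflection \<beta> \<otimes> w) + card (obstructions w \<beta>) + 1 = len w"
proof -
  have v: "reflection \<beta> \<otimes> w \<in> carrier G"
    using assms positive_root by (auto simp: mem_inversions)
  have fin: "finite (inversions w)" and card: "card (inversions w) = len w"
    using card_inversions w by auto
  have sub: "obstructions w \<beta> \<subseteq> inversions w - {\<beta>}" by (auto simp: obstructions_def)
  have "len (reflection \<beta> \<otimes> w) = card (inversions w - {\<beta>} - obstructions w \<beta>)"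
    using bij_betw_same_card[OF bij_betw_inversions_reflection[OF assms]] card_inversions[OF v] by simp
  also have "\<dots> = card (inversions w - {\<beta>}) - card (obstructions w \<beta>)"
    using sub fin by (intro card_Diff_subset) (auto intro: finite_subset)
  finally have "len (reflection \<beta> \<otimes> w) = card (inversions w - {\<beta>}) - card (obstructions w \<beta>)" .
  moreover have "card (obstructions w \<beta>) \<le> card (inversions w - {\<beta>})"
    using sub fin by (intro card_mono) auto
  moreover have "card (inversions w - {\<beta>}) + 1 = len w"
    using card_Suc_Diff1[OF fin \<beta>] card by linarith
  ultimately show ?thesis by linarith
qed

corollary len_reflection_less:
  "w \<in> carrier G \<Longrightarrow> \<beta> \<in> inversions w \<Longrightarrow> len (reflection \<beta> \<otimes> w) < len w"
  using len_reflection[of w \<beta>] by simp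

section \<open>The base of an inversion set in terms of lengths\<close>

lemma inversions_cone:
  assumes "w \<in> carrier G" "u \<in> cone_of (inversions w)"
  shows "u \<in> simple_cone" "- \<rho> (inv w) u \<in> simple_cone"
proof -
  let ?T = "{u \<in> simple_cone. - \<rho> (inv w) u \<in> simple_cone}"
  have "convex_cone ({u. id u \<in> simple_cone} \<inter> {u. - \<rho> (inv w) u \<in> simple_cone})"
    using assms(1) by (intro convex_cone_inter convex_cone_vimage linear_compose_neg action_linear linear_id) auto
  then have "convex_cone ?T" by (simp add: Collect_conj_eq)
  moreover have "inversions w \<subseteq> ?T" using assms(1) by (auto simp: mem_inversions positive_cone)
  ultimately have "cone_of (inversions w) \<subseteq> ?T" by (intro cone_of_minimal)
  then show "u \<in> simple_cone" "- \<rho> (inv w) u \<in> simple_cone" using assms(2) by auto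
qed

text \<open>
  A root on an extreme ray lies in the cone of the inversions, on which \<open>w\<^sup>-\<^sup>1\<close> is
  negative.
\<close>

lemma mem_inv_base_imp_inversion:
  assumes "w \<in> carrier G" "\<beta> \<in> inv_base G S \<rho> \<alpha> w"
  shows "\<beta> \<in> inversions w" "\<beta> \<in> positive_roots"
    "extreme_ray (cone_of (inversions w)) (open_ray \<beta>)"
proof -
  show \<beta>: "\<beta> \<in> positive_roots" and ext: "extreme_ray (cone_of (inversions w)) (open_ray \<beta>)"
    using assms(2) by (auto simp: inv_base_def)
  then obtain v where v: "v \<in> cone_of (inversions w)" "open_ray \<beta> = open_ray v"
    unfolding extreme_ray_def by blast
  have "\<beta> = 1 *\<^sub>R \<beta>" by simp
  then have "\<beta> \<in> open_ray \<beta>" unfolding open_ray_def using zero_less_one by blast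
  then obtain c where "\<beta> = c *\<^sub>R v" "0 < c" using v unfolding open_ray_def by auto
  then have "\<beta> \<in> cone_of (inversions w)" using v by (simp add: cone_of_scale)
  then have "- \<rho> (inv w) \<beta> \<in> positive_roots"
    using inversions_cone assms \<beta> by (meson inv_closed positiveI positive_root root_act root_neg)
  then show "\<beta> \<in> inversions w" using assms \<beta> by (simp add: mem_inversions)
qed

lemma extreme_imp_no_obstruction:
  assumes w: "w \<in> carrier G" and \<beta>: "\<beta> \<in> inversions w"
    and ext: "extreme_ray (cone_of (inversions w)) (open_ray \<beta>)"
  shows "obstructions w \<beta> = {}"
proof (rule ccontr)
  assume "\<not> ?thesis"
  then obtain \<gamma> where "\<gamma> \<in> inversions w" "\<gamma> \<noteq> \<beta>" "- \<rho> (reflection \<beta>) \<gamma> \<in> inversions w"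
    by (auto simp: obstructions_def)
  define \<delta> where "\<delta> = - \<rho> (reflection \<beta>) \<gamma>"
  have \<gamma>: "\<gamma> \<in> inversions w" "\<gamma> \<in> positive_roots" "\<gamma> \<noteq> \<beta>"
    and \<delta>: "\<delta> \<in> inversions w" "\<delta> \<in> positive_roots" and \<beta>pos: "\<beta> \<in> positive_roots"
    using \<open>\<gamma> \<in> inversions w\<close> \<open>\<gamma> \<noteq> \<beta>\<close> \<open>- \<rho> (reflection \<beta>) \<gamma> \<in> inversions w\<close> \<beta> w
    by (auto simp: mem_inversions \<delta>_def)
  have pair: "\<gamma> + \<delta> = (2 * B \<beta> \<gamma>) *\<^sub>R \<beta>" "0 < B \<beta> \<gamma>"
    using reflected_pair[OF \<beta>pos \<gamma>(2)] \<delta>(2) by (simp_all add: \<delta>_def)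
  have "open_ray \<beta> \<subseteq> cone_of {\<gamma>, \<delta>}"
  proof
    fix u assume "u \<in> open_ray \<beta>"
    then obtain c where c: "0 < c" "u = c *\<^sub>R \<beta>" by (auto simp: open_ray_def)
    have "u = (c / (2 * B \<beta> \<gamma>)) *\<^sub>R ((2 * B \<beta> \<gamma>) *\<^sub>R \<beta>)" using c pair(2) by simp
    also have "\<dots> = (c / (2 * B \<beta> \<gamma>)) *\<^sub>R (\<gamma> + \<delta>)" by (simp only: pair(1))
    also have "\<dots> \<in> cone_of {\<gamma>, \<delta>}"
      using c pair(2) by (intro cone_of_scale cone_of_add cone_of_incl) auto
    finally show "u \<in> cone_of {\<gamma>, \<delta>}" .
  qed
  then have "\<gamma> \<in> open_ray \<beta> \<or> \<delta> \<in> open_ray \<beta>"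
    using ext \<gamma>(1) \<delta>(1) by (auto simp: extreme_ray_def intro: cone_of_incl)
  then have "\<gamma> = \<beta> \<or> \<delta> = \<beta>"
    using positive_proportional_eq \<gamma>(2) \<delta>(2) \<beta>pos by (auto simp: open_ray_def)
  then have "\<delta> = \<beta>" using \<gamma> by simp
  then have "\<rho> (reflection \<beta>) \<gamma> = \<rho> (reflection \<beta>) \<beta>"
    using \<beta>pos unfolding \<delta>_def by (simp add: act_refl_self positive_root minus_equation_iff[of "\<rho> _ _"])
  then have "\<gamma> = \<beta>" using \<beta>pos by (metis act_refl_refl positive_root)
  then show False using \<gamma>(3) by simp
qed

text \<open>
  Without obstructions the inversions other than \<open>\<beta>\<close> lie in \<open>K1 \<union>
  K2\<close>, where \<open>s\<^sub>\<beta>\<close> keeps \<open>K1\<close> in the simple cone and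
  \<open>w\<^sup>-\<^sup>1 s\<^sub>\<beta>\<close> maps \<open>K2\<close> to its negative. The heart is
  the step \<open>vanish\<close>: no nontrivial sum of elements of the two cones is a multiple \<open>d
  \<beta>\<close>. One of the summands, \<open>x\<^sub>1\<close> say, has \<open>2 B(\<beta>, x\<^sub>1)
  \<ge> d\<close>. Then \<open>s\<^sub>\<beta> x\<^sub>1 + x\<^sub>2 + (2 B(\<beta>, x\<^sub>1) - d)
  \<beta> = 0\<close> has all three terms in the simple cone. For \<open>x\<^sub>2\<close> the same holds
  after applying \<open>- w\<^sup>-\<^sup>1\<close>, under which the two kinds of inversions change
  roles.
\<close>

lemma no_obstruction_imp_extreme:
  assumes w: "w \<in> carrier G" and \<beta>: "\<beta> \<in> inversions w" and none: "obstructions w \<beta> = {}"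
  shows "extreme_ray (cone_of (inversions w)) (open_ray \<beta>)"
proof -
  define r where "r = \<rho> (reflection \<beta>)"
  define n where "n u = - \<rho> (inv w) u" for u
  have \<beta>pos: "\<beta> \<in> positive_roots" and n\<beta>: "n \<beta> \<in> simple_cone"
    using \<beta> w by (auto simp: mem_inversions n_def positive_cone)
  then have \<beta>root: "\<beta> \<in> root_system" using positive_root by blast
  have r: "r u = u - (2 * B \<beta> u) *\<^sub>R \<beta>" for u using \<beta>root by (simp add: r_def act_refl)
  have lin_r: "linear r" using \<beta>root by (simp add: r_def action_linear)
  have lin_n: "linear n" unfolding n_def using w by (intro linear_compose_neg action_linear) auto
  have r0: "u = 0" if "r u = 0" for u
    using that act_refl_refl[OF \<beta>root, of u] by (simp add: r_def \<beta>root)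
  have n0: "u = 0" if "n u = 0" for u
    using that act_inv(2)[OF w, of u] w by (simp add: n_def)
  define K where "K = {u. u \<in> simple_cone \<and> n u \<in> simple_cone}"
  define K1 where "K1 = {u \<in> K. r u \<in> simple_cone}"
  define K2 where "K2 = {u \<in> K. n (r u) \<in> simple_cone}"
  have K: "K = {u. id u \<in> simple_cone} \<inter> {u. n u \<in> simple_cone}" by (auto simp: K_def)
  have "convex_cone K" unfolding K by (intro convex_cone_inter convex_cone_vimage lin_n linear_id)
  moreover have "K1 = K \<inter> {u. r u \<in> simple_cone}" "K2 = K \<inter> {u. (n \<circ> r) u \<in> simple_cone}"
    by (auto simp: K1_def K2_def)
  ultimately have cc: "convex_cone K1" "convex_cone K2"
    by (simp_all only: convex_cone_inter convex_cone_vimage lin_r lin_n linear_compose)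

  have vanish: "x1 = 0 \<and> x2 = 0" if x: "x1 \<in> K1" "x2 \<in> K2" "x1 + x2 = d *\<^sub>R \<beta>" for x1 x2 d
  proof -
    have pos: "x1 \<in> simple_cone" "n x1 \<in> simple_cone" "r x1 \<in> simple_cone"
      "x2 \<in> simple_cone" "n (r x2) \<in> simple_cone"
      using x by (auto simp: K1_def K2_def K_def)
    have "d = B \<beta> (d *\<^sub>R \<beta>)" using \<beta>pos by (simp add: positive_norm)
    then have d: "d = B \<beta> x1 + B \<beta> x2" unfolding x(3)[symmetric] by simp
    consider "d \<le> 2 * B \<beta> x1" | "d \<le> 2 * B \<beta> x2" using d by linarith
    then show ?thesis
    proof cases
      case 1
      have "r x1 + x2 + (2 * B \<beta> x1 - d) *\<^sub>R \<beta> = (x1 + x2) - d *\<^sub>R \<beta>"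
        by (simp add: r algebra_simps)
      then have sum: "r x1 + x2 + (2 * B \<beta> x1 - d) *\<^sub>R \<beta> = 0" using x(3) by simp
      have "(2 * B \<beta> x1 - d) *\<^sub>R \<beta> \<in> simple_cone"
        using 1 \<beta>pos by (intro cone_of_scale) (auto simp: positive_cone)
      then have "r x1 = 0" "x2 = 0"
        using simple_cone_salient3[OF pos(3,4) _ sum] by auto
      then show ?thesis using r0 by blast
    next
      case 2
      have "x1 + r x2 + (2 * B \<beta> x2 - d) *\<^sub>R \<beta> = (x1 + x2) - d *\<^sub>R \<beta>"
        by (simp add: r algebra_simps)
      then have "n (x1 + r x2 + (2 * B \<beta> x2 - d) *\<^sub>R \<beta>) = 0"
        using x(3) by (simp add: linear_0[OF lin_n])
      then have sum: "n x1 + n (r x2) + (2 * B \<beta> x2 - d) *\<^sub>R n \<beta> = 0"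
        by (simp add: linear_add[OF lin_n] linear_scale[OF lin_n])
      have "(2 * B \<beta> x2 - d) *\<^sub>R n \<beta> \<in> simple_cone"
        using 2 n\<beta> by (intro cone_of_scale) auto
      then have "n x1 = 0" "n (r x2) = 0"
        using simple_cone_salient3[OF pos(2,5) _ sum] by auto
      then show ?thesis using r0 n0 by blast
    qed
  qed

  \<comment> \<open>Adjoining the ray of \<open>\<beta>\<close> itself yields a convex cone that contains all inversions.\<close>
  define D where "D = {c *\<^sub>R \<beta> + x1 + x2 | c x1 x2. 0 \<le> c \<and> x1 \<in> K1 \<and> x2 \<in> K2}"
  have zero: "0 \<in> K1" "0 \<in> K2" using cc by (auto simp: convex_cone_iff)
  have D: "cone_of (inversions w) \<subseteq> D"
  proof (rule cone_of_minimal)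
    show "convex_cone D" unfolding convex_cone_iff
    proof (intro conjI ballI allI impI)
      have "0 = 0 *\<^sub>R \<beta> + 0 + 0" by simp
      then show "0 \<in> D" unfolding D_def using zero by blast
    next
      fix x y assume "x \<in> D" "y \<in> D"
      then obtain c x1 x2 c' y1 y2 where xy: "x = c *\<^sub>R \<beta> + x1 + x2" "y = c' *\<^sub>R \<beta> + y1 + y2"
        "0 \<le> c" "0 \<le> c'" "x1 \<in> K1" "x2 \<in> K2" "y1 \<in> K1" "y2 \<in> K2"
        unfolding D_def by blast
      then have "x + y = (c + c') *\<^sub>R \<beta> + (x1 + y1) + (x2 + y2)" by (simp add: algebra_simps)
      moreover have "0 \<le> c + c'" "x1 + y1 \<in> K1" "x2 + y2 \<in> K2"
        using xy cc by (auto simp: convex_cone_iff)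
      ultimately show "x + y \<in> D" unfolding D_def by blast
    next
      fix x and a :: real assume "x \<in> D" "0 \<le> a"
      then obtain c x1 x2 where x: "x = c *\<^sub>R \<beta> + x1 + x2" "0 \<le> c" "x1 \<in> K1" "x2 \<in> K2"
        unfolding D_def by blast
      then have "a *\<^sub>R x = (a * c) *\<^sub>R \<beta> + a *\<^sub>R x1 + a *\<^sub>R x2" by (simp add: algebra_simps)
      moreover have "0 \<le> a * c" "a *\<^sub>R x1 \<in> K1" "a *\<^sub>R x2 \<in> K2"
        using x cc \<open>0 \<le> a\<close> by (auto simp: convex_cone_iff)
      ultimately show "a *\<^sub>R x \<in> D" unfolding D_def by blast
    qed
    show "inversions w \<subseteq> D"
    proof
      fix \<gamma> assume \<gamma>: "\<gamma> \<in> inversions w"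
      have \<gamma>K: "\<gamma> \<in> K" and \<gamma>root: "\<gamma> \<in> positive_roots"
        using \<gamma> w by (auto simp: K_def n_def mem_inversions positive_cone)
      consider "\<gamma> = \<beta>" | "\<gamma> \<in> K1" | "\<gamma> \<in> K2"
      proof (cases "\<gamma> = \<beta> \<or> r \<gamma> \<in> simple_cone")
        case True
        then show ?thesis using that \<gamma>K by (auto simp: K1_def)
      next
        case False
        then have "- r \<gamma> \<in> positive_roots"
          using root_positive_or_negative[of "r \<gamma>"] root_act \<gamma>root \<beta>root
          by (auto simp: positive_root positive_cone r_def)
        moreover have "- r \<gamma> \<notin> inversions w"
          using none \<gamma> False by (auto simp: obstructions_def r_def)
        ultimately have "\<rho> (inv w) (- r \<gamma>) \<in> positive_roots" using w by (simp add: not_mem_inversions)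
        then have "n (r \<gamma>) \<in> simple_cone" using w positive_cone by (simp add: n_def)
        then show ?thesis using that \<gamma>K by (auto simp: K2_def)
      qed
      then show "\<gamma> \<in> D"
      proof cases
        case 1
        have "\<beta> = 1 *\<^sub>R \<beta> + 0 + 0" by simp
        then show ?thesis unfolding 1 D_def using zero zero_le_one by blast
      next
        case 2
        have "\<gamma> = 0 *\<^sub>R \<beta> + \<gamma> + 0" by simp
        then show ?thesis unfolding D_def using zero 2 by blast
      next
        case 3
        have "\<gamma> = 0 *\<^sub>R \<beta> + 0 + \<gamma>" by simp
        then show ?thesis unfolding D_def using zero 3 by blast
      qed
    qed
  qed

  have ray_of_multiple: "u \<in> open_ray \<beta>" if "p *\<^sub>R u = c *\<^sub>R \<beta>" "0 \<le> p" "0 < c" for u p c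
  proof -
    have "p \<noteq> 0" using that positive_nonzero[OF \<beta>pos] by auto
    then have "u = inverse p *\<^sub>R (p *\<^sub>R u)" by simp
    then have "u = (inverse p * c) *\<^sub>R \<beta>" unfolding that(1) by simp
    moreover have "0 < inverse p * c" using \<open>p \<noteq> 0\<close> that by simp
    ultimately show ?thesis unfolding open_ray_def by blast
  qed

  show ?thesis unfolding extreme_ray_def
  proof (intro conjI ballI impI)
    show "\<exists>v\<in>cone_of (inversions w) - {0}. open_ray \<beta> = open_ray v"
      using \<beta> \<beta>pos by (intro bexI[of _ \<beta>]) (auto intro: cone_of_incl simp: positive_nonzero)
  next
    fix b g assume bg: "b \<in> cone_of (inversions w)" "g \<in> cone_of (inversions w)"
      and ray: "open_ray \<beta> \<subseteq> cone_of {b, g}"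
    have "\<beta> = 1 *\<^sub>R \<beta>" by simp
    then have "\<beta> \<in> open_ray \<beta>" unfolding open_ray_def using zero_less_one by blast
    then obtain p q where pq: "0 \<le> p" "0 \<le> q" "\<beta> = p *\<^sub>R b + q *\<^sub>R g"
      using ray cone_of_pair by blast
    have "p *\<^sub>R b \<in> D" "q *\<^sub>R g \<in> D" using bg pq D by (auto intro!: subsetD[OF D] cone_of_scale)
    then obtain c x1 x2 c' y1 y2 where
      b: "p *\<^sub>R b = c *\<^sub>R \<beta> + x1 + x2" "0 \<le> c" "x1 \<in> K1" "x2 \<in> K2" and
      g: "q *\<^sub>R g = c' *\<^sub>R \<beta> + y1 + y2" "0 \<le> c'" "y1 \<in> K1" "y2 \<in> K2"
      unfolding D_def by blast
    have "(x1 + y1) + (x2 + y2) = (p *\<^sub>R b + q *\<^sub>R g) - (c + c') *\<^sub>R \<beta>"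
      unfolding b g by (simp add: algebra_simps)
    then have "(x1 + y1) + (x2 + y2) = (1 - c - c') *\<^sub>R \<beta>"
      by (simp add: pq(3)[symmetric] algebra_simps)
    moreover have "x1 + y1 \<in> K1" "x2 + y2 \<in> K2" using b g cc by (auto simp: convex_cone_iff)
    ultimately have "x1 + y1 = 0" "x2 + y2 = 0" using vanish by blast+
    then have zeros: "x1 = 0" "y1 = 0" "x2 = 0" "y2 = 0"
      using b g simple_cone_salient by (auto simp: K1_def K2_def K_def)
    then have "\<beta> = (c + c') *\<^sub>R \<beta>" using pq(3) b(1) g(1) by (simp add: algebra_simps)
    then have "(1 - (c + c')) *\<^sub>R \<beta> = 0" by (simp add: algebra_simps)
    then have "c + c' = 1" using positive_nonzero[OF \<beta>pos] by simp
    then consider "0 < c" | "0 < c'" using b g by linarith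
    then show "b \<in> open_ray \<beta> \<or> g \<in> open_ray \<beta>"
    proof cases
      case 1
      then show ?thesis using ray_of_multiple[of p b c] b(1) zeros pq(1) by simp
    next
      case 2
      then show ?thesis using ray_of_multiple[of q g c'] g(1) zeros pq(2) by simp
    qed
  qed
qed

theorem mem_inv_base_iff:
  assumes "w \<in> carrier G"
  shows "\<beta> \<in> inv_base G S \<rho> \<alpha> w \<longleftrightarrow>
    \<beta> \<in> inversions w \<and> len (reflection \<beta> \<otimes> w) + 1 = len w"
proof -
  have "len (reflection \<beta> \<otimes> w) + 1 = len w \<longleftrightarrow> obstructions w \<beta> = {}"
    if "\<beta> \<in> inversions w"
  proof -
    have "finite (obstructions w \<beta>)"
      using card_inversions[OF assms] by (auto simp: obstructions_def intro: finite_subset[rotated])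
    then have "card (obstructions w \<beta>) = 0 \<longleftrightarrow> obstructions w \<beta> = {}" by simp
    moreover have "len (reflection \<beta> \<otimes> w) + 1 = len w \<longleftrightarrow> card (obstructions w \<beta>) = 0"
      using len_reflection[OF assms that] by arith
    ultimately show ?thesis by simp
  qed
  moreover have "\<beta> \<in> inv_base G S \<rho> \<alpha> w \<longleftrightarrow> \<beta> \<in> inversions w \<and> obstructions w \<beta> = {}"
  proof
    assume "\<beta> \<in> inv_base G S \<rho> \<alpha> w"
    then show "\<beta> \<in> inversions w \<and> obstructions w \<beta> = {}"
      using mem_inv_base_imp_inversion[OF assms] extreme_imp_no_obstruction[OF assms] by blast
  next
    assume *: "\<beta> \<in> inversions w \<and> obstructions w \<beta> = {}"
    then have "\<beta> \<in> positive_roots" using assms by (simp add: mem_inversions)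
    then show "\<beta> \<in> inv_base G S \<rho> \<alpha> w"
      using * no_obstruction_imp_extreme[OF assms] by (simp add: inv_base_def)
  qed
  ultimately show ?thesis by blast
qed

section \<open>The base under an ascent\<close>

lemma bruhat_le_len: "bruhat_le G S \<rho> B \<alpha> u v \<Longrightarrow> u = v \<or> len u < len v"
  unfolding bruhat_le_def
  by (induction rule: rtranclp_induct) (auto simp: bruhat_step_def)

lemma bruhat_less_gen_mult:
  assumes "u \<in> carrier G" "s \<in> S"
  shows "bruhat_less G S \<rho> B \<alpha> u (s \<otimes> u) \<longleftrightarrow> len u < len (s \<otimes> u)"
proof
  assume "bruhat_less G S \<rho> B \<alpha> u (s \<otimes> u)"
  then show "len u < len (s \<otimes> u)" using bruhat_le_len by (auto simp: bruhat_less_def)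
next
  assume up: "len u < len (s \<otimes> u)"
  then have "bruhat_step G S \<rho> B \<alpha> u (s \<otimes> u)"
    using assms simple_positive refl_simple unfolding bruhat_step_def by metis
  then have "bruhat_le G S \<rho> B \<alpha> u (s \<otimes> u)" unfolding bruhat_le_def by blast
  then show "bruhat_less G S \<rho> B \<alpha> u (s \<otimes> u)" using up by (auto simp: bruhat_less_def)
qed

lemma reflection_conj_gen:
  assumes "s \<in> S" "\<beta> \<in> root_system" "x \<in> carrier G"
  shows "reflection (\<rho> s \<beta>) \<otimes> (s \<otimes> x) = s \<otimes> (reflection \<beta> \<otimes> x)"
  using assms by (simp add: refl_conj m_assoc)

text \<open>
  The inversions of \<open>s x\<close> are \<open>\<alpha>\<^sub>s\<close> and the \<open>s \<beta>\<close>
  with \<open>\<beta>\<close> an inversion of \<open>x\<close>, and \<open>s\<^bsub>s\<beta>\<^esub> s x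
  = s s\<^sub>\<beta> x\<close> has length at most \<open>\<ell>(s\<^sub>\<beta> x) + 1 \<le>
  \<ell>(x)\<close>. So \<open>s \<beta>\<close> is in the base of \<open>s x\<close> precisely when both
  inequalities are equalities.
\<close>

theorem inv_base_ascent:
  assumes s: "s \<in> S" and x: "x \<in> carrier G" and up: "len x < len (s \<otimes> x)"
  shows "inv_base G S \<rho> \<alpha> (s \<otimes> x) =
    {\<alpha> s} \<union> \<rho> s ` {\<beta> \<in> inv_base G S \<rho> \<alpha> x.
      len (reflection \<beta> \<otimes> x) < len (s \<otimes> (reflection \<beta> \<otimes> x))}"
proof -
  have len: "len (s \<otimes> x) = len x + 1" using len_gen_mult[OF s x] up by simp
  have eq: "\<rho> s \<beta> \<in> inv_base G S \<rho> \<alpha> (s \<otimes> x) \<longleftrightarrow> \<beta> \<in> inv_base G S \<rho> \<alpha> x \<and>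
      len (reflection \<beta> \<otimes> x) < len (s \<otimes> (reflection \<beta> \<otimes> x))" if \<beta>: "\<beta> \<in> inversions x" for \<beta>
  proof -
    have \<beta>root: "\<beta> \<in> root_system" using \<beta> x by (simp add: mem_inversions positive_root)
    have "\<rho> s \<beta> \<in> inversions (s \<otimes> x)" using \<beta> inversions_gen_mult[OF x s up] by simp
    then have "\<rho> s \<beta> \<in> inv_base G S \<rho> \<alpha> (s \<otimes> x) \<longleftrightarrow> len (s \<otimes> (reflection \<beta> \<otimes> x)) = len x"
      using s x \<beta>root len by (simp add: mem_inv_base_iff reflection_conj_gen)
    moreover have "\<beta> \<in> inv_base G S \<rho> \<alpha> x \<longleftrightarrow> len (reflection \<beta> \<otimes> x) + 1 = len x"
      using \<beta> x by (simp add: mem_inv_base_iff)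
    moreover have "len (reflection \<beta> \<otimes> x) < len x" using len_reflection_less[OF x \<beta>] .
    moreover note len_gen_mult[OF s, of "reflection \<beta> \<otimes> x"]
    ultimately show ?thesis using x \<beta>root by auto
  qed
  have "\<alpha> s \<in> inv_base G S \<rho> \<alpha> (s \<otimes> x)"
    using s x len simple_inversion[of "s \<otimes> x" s] by (simp add: mem_inv_base_iff refl_simple)
  moreover have "inv_base G S \<rho> \<alpha> (s \<otimes> x) \<subseteq> insert (\<alpha> s) (\<rho> s ` inversions x)"
    using s x inversions_gen_mult[OF x s up] by (auto simp: mem_inv_base_iff)
  moreover have "inv_base G S \<rho> \<alpha> x \<subseteq> inversions x" using x by (auto simp: mem_inv_base_iff)
  ultimately show ?thesis using eq by blast
qed

section \<open>The base under a descent\<close>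

text \<open>
  Here \<open>a\<close> and \<open>b\<close> span the cone of the positive roots of their plane. Let
  \<open>p n\<close> be the product of the first \<open>n\<close> terms of \<open>s\<^sub>a, s\<^sub>b,
  s\<^sub>a, \<dots>\<close> and \<open>\<beta> n\<close> the image under \<open>p n\<close> of
  \<open>a\<close> or \<open>b\<close>, whichever belongs to the next factor; these are the roots of the
  plane in angular order from \<open>a\<close>. Let \<open>k\<close> be the first index for which
  \<open>\<beta> k\<close> is not an inversion of \<open>x\<close>, and write \<open>x = p k \<cdot>
  y\<close>. Then \<open>\<gamma> = \<beta> (k - 1)\<close> works: \<open>s\<^sub>\<gamma> x = p (k - 1)
  \<cdot> y\<close>, while \<open>s\<^sub>b s\<^sub>a x = p (k - 2) \<cdot> y\<close> since cancelling
  the first two factors also leaves \<open>k - 2\<close> alternating ones starting with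
  \<open>s\<^sub>a\<close>. These elements differ by the reflection in \<open>\<beta> (k - 2)\<close>,
  which is an inversion of the former because \<open>x\<^sup>-\<^sup>1\<close> is positive on
  \<open>\<beta> k\<close>.
\<close>

lemma dihedral_last_inversion_long:
  assumes x: "x \<in> carrier G" and a: "a \<in> positive_roots" and b: "b \<in> positive_roots"
    and plane: "\<And>c d. c *\<^sub>R a + d *\<^sub>R b \<in> positive_roots \<Longrightarrow> 0 \<le> c \<and> 0 \<le> d"
    and inv0: "a \<in> inversions x" and inv1: "\<rho> (reflection a) b \<in> inversions x"
  shows "\<exists>\<gamma> c d. \<gamma> \<in> inversions x \<and> \<gamma> \<noteq> a \<and> \<gamma> = c *\<^sub>R a + d *\<^sub>R b \<and>
    len (reflection b \<otimes> (reflection a \<otimes> x)) < len (reflection \<gamma> \<otimes> x)"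
proof -
  define r where "r n = (if even n then a else b)" for n :: nat
  define q where "q n = reflection (r n)" for n
  define p where "p n = alt_prod (reflection a) (reflection b) n" for n
  define \<beta> where "\<beta> n = \<rho> (p n) (r n)" for n
  define y where "y n = inv (p n) \<otimes> x" for n
  have ab: "a \<in> root_system" "b \<in> root_system" using a b positive_root by auto
  have r: "r n \<in> positive_roots" "r n \<in> root_system" for n using a b ab by (auto simp: r_def)
  have q [simp]: "q n \<in> carrier G" for n using r by (simp add: q_def)
  have q_r: "\<rho> (q n) (r n) = - r n" for n using r by (simp add: q_def act_refl_self)
  have qq [simp]: "\<rho> (q n) (\<rho> (q n) v) = v" for n v using r by (simp add: q_def)
  have inv_q [simp]: "inv (q n) = q n" for n using r by (simp add: q_def)
  have p [simp]: "p n \<in> carrier G" for n using ab by (simp add: p_def)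
  have p_cancel: "inv (p n) \<otimes> (p n \<otimes> h) = h" and q_cancel: "q n \<otimes> (q n \<otimes> h) = h"
    if "h \<in> carrier G" for n h
    using that r by (simp_all add: q_def flip: m_assoc)
  have p_0: "p 0 = \<one>" by (simp add: p_def)
  have p_Suc: "p (Suc n) = p n \<otimes> q n" for n by (simp add: p_def q_def r_def)
  have p_Suc_Suc: "p (Suc (Suc n)) = reflection a \<otimes> (reflection b \<otimes> p n)" for n
    unfolding p_def using ab by (simp only: alt_prod_Suc_left refl_closed alt_prod_closed)
  have y: "y n \<in> carrier G" for n using x by (simp add: y_def)
  have x_y: "x = p n \<otimes> y n" for n using x by (simp add: y_def flip: m_assoc)
  have \<beta>: "\<beta> n \<in> root_system" for n using r by (simp add: \<beta>_def root_act)
  have refl_\<beta>: "reflection (\<beta> n) = p n \<otimes> q n \<otimes> inv (p n)" for n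
    using r by (simp add: \<beta>_def q_def refl_conj)
  have act_y: "\<rho> (inv (y n)) v = \<rho> (inv x) (\<rho> (p n) v)" for n v
    using x by (simp add: y_def inv_mult_group act_mult)

  define P where "P v \<longleftrightarrow> (\<exists>c d. v = c *\<^sub>R a + d *\<^sub>R b)" for v
  have P_ab: "P a" "P b"
    unfolding P_def by (rule exI[of _ 1], rule exI[of _ 0], simp, rule exI[of _ 0], rule exI[of _ 1], simp)
  have P_lin: "P (c *\<^sub>R u + d *\<^sub>R v)" if "P u" "P v" for c d u v
  proof -
    obtain k l m n where "u = k *\<^sub>R a + l *\<^sub>R b" "v = m *\<^sub>R a + n *\<^sub>R b" using \<open>P u\<close> \<open>P v\<close> P_def by blast
    then have "c *\<^sub>R u + d *\<^sub>R v = (c * k + d * m) *\<^sub>R a + (c * l + d * n) *\<^sub>R b"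
      by (simp add: algebra_simps)
    then show ?thesis unfolding P_def by blast
  qed
  have P_r: "P (r n)" for n using P_ab by (simp add: r_def)
  have P_q: "P (\<rho> (q n) v)" if "P v" for n v
    using P_lin[of v "r n" 1 "- (2 * B (r n) v)"] P_r that r by (simp add: q_def act_refl)
  have P_p: "P v \<Longrightarrow> P (\<rho> (p n) v)" for n v
    by (induction n arbitrary: v) (auto simp: p_0 p_Suc act_mult P_q)
  have P_pinv: "P v \<Longrightarrow> P (\<rho> (inv (p n)) v)" for n v
    by (induction n arbitrary: v) (auto simp: p_0 p_Suc act_mult inv_mult_group P_q)

  \<comment> \<open>Within the plane, \<open>s\<^sub>a\<close> and \<open>s\<^sub>b\<close> behave like simple reflections.\<close>
  have stays_pos: "\<rho> (q n) v \<in> positive_roots" if v: "v \<in> positive_roots" "P v" "v \<noteq> r n" for n v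
  proof (rule ccontr)
    assume "\<not> ?thesis"
    then have neg: "- \<rho> (q n) v \<in> positive_roots"
      using root_positive_or_negative[of "\<rho> (q n) v"] v(1) root_act positive_root by auto
    obtain c d where cd: "v = c *\<^sub>R a + d *\<^sub>R b" using v P_def by blast
    have nn: "0 \<le> c" "0 \<le> d" using plane v(1) cd by auto
    let ?k = "2 * B (r n) v"
    have neg': "?k *\<^sub>R r n - v \<in> positive_roots" using neg r by (simp add: q_def act_refl)
    have "if even n then d = 0 else c = 0"
    proof (cases "even n")
      case True
      then have "?k *\<^sub>R r n - v = (?k - c) *\<^sub>R a + (- d) *\<^sub>R b" by (simp add: cd r_def algebra_simps)
      then have "0 \<le> - d" using plane[of "?k - c" "- d"] neg' by simp
      then show ?thesis using nn True by simp
    next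
      case False
      then have "?k *\<^sub>R r n - v = (- c) *\<^sub>R a + (?k - d) *\<^sub>R b" by (simp add: cd r_def algebra_simps)
      then have "0 \<le> - c" using plane[of "- c" "?k - d"] neg' by simp
      then show ?thesis using nn False by simp
    qed
    then have "\<exists>e. v = e *\<^sub>R r n" using cd by (auto simp: r_def split: if_splits)
    then show False using v r positive_proportional_eq by blast
  qed

  \<comment> \<open>Each inversion \<open>\<beta> n\<close> of \<open>x\<close> makes \<open>y (Suc n)\<close> shorter than
        \<open>y n\<close>.\<close>
  have ex: "\<exists>n. \<beta> n \<notin> inversions x"
  proof (rule ccontr)
    assume all: "\<not> ?thesis"
    have "len (y n) + n \<le> len x" for n
    proof (induction n)
      case (Suc n)
      have "r n \<in> inversions (y n)"
        using all x y r by (simp add: mem_inversions act_y \<beta>_def)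
      then have "len (q n \<otimes> y n) < len (y n)" unfolding q_def using len_reflection_less y by blast
      moreover have "y (Suc n) = q n \<otimes> y n" using x by (simp add: y_def p_Suc inv_mult_group m_assoc)
      ultimately show ?case using Suc by simp
    qed (use x in \<open>simp add: y_def p_0\<close>)
    from this[of "Suc (len x)"] show False by simp
  qed
  define k where "k = (LEAST n. \<beta> n \<notin> inversions x)"
  have k: "\<beta> k \<notin> inversions x" unfolding k_def using ex by (rule LeastI_ex)
  have below: "\<beta> i \<in> inversions x" if "i < k" for i
    using not_less_Least[OF that[unfolded k_def]] by simp
  have below_pos: "\<beta> i \<in> positive_roots" if "i < k" for i
    using below[OF that] x by (simp add: mem_inversions)
  have "\<beta> 0 = a" "\<beta> (Suc 0) = \<rho> (reflection a) b"
    using ab by (simp_all add: \<beta>_def p_0 p_Suc r_def q_def)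
  then have "\<beta> 0 \<in> inversions x" "\<beta> (Suc 0) \<in> inversions x" using inv0 inv1 by simp_all
  then have "k \<noteq> 0" "k \<noteq> Suc 0" using k by metis+
  then obtain m where m: "k = Suc (Suc m)" by (metis not0_implies_Suc)

  have p_back: "\<rho> (p (Suc n)) (r n) = - \<beta> n" for n
    using r by (simp add: p_Suc act_mult q_r \<beta>_def)

  have "\<rho> (inv x) (\<beta> k) \<in> simple_cone"
  proof (cases "\<beta> k \<in> positive_roots")
    case True
    then show ?thesis using k x not_mem_inversions positive_cone by blast
  next
    case False
    then have negk: "- \<beta> k \<in> positive_roots" using \<beta> root_positive_or_negative by blast
    \<comment> \<open>The dihedral group is finite and \<open>p k\<close> its longest element. Then \<open>b\<close> occurs
          among the earlier roots \<open>\<beta> j\<close>, so that \<open>x\<^sup>-\<^sup>1\<close> is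
          negative on the whole cone of \<open>a\<close> and \<open>b\<close>, which contains \<open>-
          \<beta> k\<close>.\<close>
    have b_neg: "\<rho> (inv (p k)) b \<notin> positive_roots"
    proof
      assume pos: "\<rho> (inv (p k)) b \<in> positive_roots"
      obtain c d where cd: "\<rho> (inv (p k)) b = c *\<^sub>R a + d *\<^sub>R b" using P_pinv P_ab P_def by blast
      have nn: "0 \<le> c" "0 \<le> d" using plane pos cd by auto
      define c' where "c' = (if even k then c else d)"
      define d' where "d' = (if even k then d else c)"
      have "\<rho> (inv (p k)) b = c' *\<^sub>R r k + d' *\<^sub>R r (Suc m)"
        using cd by (simp add: c'_def d'_def r_def m)
      then have "\<rho> (p k) (\<rho> (inv (p k)) b) = \<rho> (p k) (c' *\<^sub>R r k + d' *\<^sub>R r (Suc m))" by simp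
      then have "b = c' *\<^sub>R \<beta> k + d' *\<^sub>R (- \<beta> (Suc m))"
        using p_back[of "Suc m"] by (simp add: m \<beta>_def)
      then have "b + c' *\<^sub>R (- \<beta> k) + d' *\<^sub>R \<beta> (Suc m) = 0" by simp
      moreover have "c' *\<^sub>R (- \<beta> k) \<in> simple_cone" "d' *\<^sub>R \<beta> (Suc m) \<in> simple_cone"
        using nn negk below_pos[of "Suc m"] m
        by (auto intro!: cone_of_scale[OF _ positive_cone] simp only: c'_def d'_def split: if_splits)
      ultimately have "b = 0" using simple_cone_salient3(1) b positive_cone by blast
      then show False using b positive_nonzero by blast
    qed
    \<comment> \<open>At the step where the image of \<open>b\<close> turns negative, it is the root that is being reflected.\<close>
    define i where "i = (LEAST n. \<rho> (inv (p n)) b \<notin> positive_roots)"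
    have i: "\<rho> (inv (p i)) b \<notin> positive_roots" "i \<le> k"
      unfolding i_def using LeastI[of "\<lambda>n. \<rho> (inv (p n)) b \<notin> positive_roots", OF b_neg]
        Least_le[of "\<lambda>n. \<rho> (inv (p n)) b \<notin> positive_roots", OF b_neg] by blast+
    have "i \<noteq> 0" using i(1) b p_0 by (metis act_one inv_one)
    then obtain j where j: "i = Suc j" using not0_implies_Suc by blast
    have "\<rho> (inv (p j)) b \<in> positive_roots" using not_less_Least[of j "\<lambda>n. \<rho> (inv (p n)) b \<notin> positive_roots"] j unfolding i_def by simp
    moreover have "\<rho> (q j) (\<rho> (inv (p j)) b) \<notin> positive_roots"
      using i(1) by (simp add: j p_Suc inv_mult_group act_mult)
    ultimately have "\<rho> (inv (p j)) b = r j" using stays_pos P_pinv P_ab by blast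
    then have "b = \<beta> j" unfolding \<beta>_def by (metis act_inv(2) p)
    then have b_inv: "b \<in> inversions x" using below[of j] i(2) j by simp
    have "P (- \<beta> k)" using P_lin[of "\<beta> k" "\<beta> k" "-1" 0] P_p P_r by (simp add: \<beta>_def)
    then obtain c d where cd: "- \<beta> k = c *\<^sub>R a + d *\<^sub>R b" using P_def by blast
    have nn: "0 \<le> c" "0 \<le> d" using plane negk cd by auto
    have "\<rho> (inv x) (\<beta> k) = - \<rho> (inv x) (- \<beta> k)" using x by simp
    also have "\<dots> = c *\<^sub>R (- \<rho> (inv x) a) + d *\<^sub>R (- \<rho> (inv x) b)" unfolding cd using x by simp
    also have "\<dots> \<in> simple_cone" using nn inv0 b_inv x
      by (intro cone_of_add cone_of_scale) (auto simp: mem_inversions positive_cone)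
    finally show ?thesis .
  qed
  \<comment> \<open>The roots \<open>r m\<close> and \<open>r k\<close> agree because \<open>k = m + 2\<close>.\<close>
  then have y_k: "\<rho> (inv (y k)) (r m) \<in> positive_roots"
    using r[of m] y[of k] by (intro act_positiveI) (auto simp: act_y \<beta>_def r_def m)

  define \<gamma> where "\<gamma> = \<beta> (Suc m)"
  define \<tau> where "\<tau> = \<beta> m"
  have \<gamma>: "\<gamma> \<in> inversions x" "P \<gamma>" using below P_p P_r by (simp_all add: \<gamma>_def m \<beta>_def)
  have \<tau>: "\<tau> \<in> positive_roots" using below_pos by (simp add: \<tau>_def m)
  have u: "reflection \<gamma> \<otimes> x = p (Suc m) \<otimes> y k"
  proof -
    have "reflection \<gamma> \<otimes> x = p (Suc m) \<otimes> q (Suc m) \<otimes> inv (p (Suc m)) \<otimes> (p k \<otimes> y k)"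
      using x_y[of k] by (simp add: \<gamma>_def refl_\<beta>)
    also have "p k = p (Suc m) \<otimes> q (Suc m)" by (simp add: m p_Suc)
    also have "p (Suc m) \<otimes> q (Suc m) \<otimes> inv (p (Suc m)) \<otimes> (p (Suc m) \<otimes> q (Suc m) \<otimes> y k) =
        p (Suc m) \<otimes> y k"
      using y by (simp add: m_assoc p_cancel q_cancel)
    finally show ?thesis .
  qed
  have "reflection \<tau> \<otimes> (p (Suc m) \<otimes> y k) = p m \<otimes> y k"
  proof -
    have "reflection \<tau> \<otimes> (p (Suc m) \<otimes> y k) = p m \<otimes> q m \<otimes> inv (p m) \<otimes> (p m \<otimes> q m \<otimes> y k)"
      by (simp add: \<tau>_def refl_\<beta> p_Suc)
    also have "\<dots> = p m \<otimes> y k"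
      using y by (simp add: m_assoc p_cancel q_cancel)
    finally show ?thesis .
  qed
  moreover have "reflection b \<otimes> (reflection a \<otimes> x) = p m \<otimes> y k"
  proof -
    have "x = reflection a \<otimes> (reflection b \<otimes> (p m \<otimes> y k))"
      using x_y[of k] y ab by (simp add: m p_Suc_Suc m_assoc)
    then show ?thesis using y ab by simp
  qed
  moreover have "\<tau> \<in> inversions (p (Suc m) \<otimes> y k)"
  proof -
    have "\<rho> (inv (p (Suc m) \<otimes> y k)) \<tau> = \<rho> (inv (y k)) (\<rho> (q m) (r m))"
      using y by (simp add: inv_mult_group act_mult p_Suc \<tau>_def \<beta>_def)
    then show ?thesis using y y_k \<tau> by (simp add: mem_inversions q_r)
  qed
  ultimately have longer: "len (reflection b \<otimes> (reflection a \<otimes> x)) < len (reflection \<gamma> \<otimes> x)"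
    using len_reflection_less[of "p (Suc m) \<otimes> y k" \<tau>] y u by simp

  \<comment> \<open>If \<open>\<gamma>\<close> were \<open>a\<close>, then \<open>p (Suc m)\<close> would send the positive
        root \<open>r (Suc m)\<close> to \<open>a\<close>. But its inverse makes \<open>a\<close>
        negative from the first factor on: to turn positive again, \<open>a\<close> would have to be some
        \<open>- \<beta> i\<close>.\<close>
  have "\<rho> (inv (p (Suc n))) a \<notin> positive_roots" if "n < k" for n
    using that
  proof (induction n)
    case 0
    then show ?case using a ab not_positive_neg by (simp add: p_0 p_Suc q_def r_def act_refl_self)
  next
    case (Suc n)
    define v where "v = \<rho> (inv (p (Suc n))) a"
    have v_root: "v \<in> root_system" using ab by (simp add: v_def root_act)
    then have v: "- v \<in> positive_roots" using Suc root_positive_or_negative v_def by auto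
    have "- v \<noteq> r (Suc n)"
    proof
      assume "- v = r (Suc n)"
      then have "\<beta> (Suc n) = - a" unfolding \<beta>_def by (simp add: v_def flip: \<open>- v = r (Suc n)\<close>)
      then show False using below_pos[OF Suc.prems] a not_positive_neg by simp
    qed
    moreover have "P (- v)" using P_lin[of v v "-1" 0] P_pinv P_ab by (simp add: v_def)
    ultimately have "\<rho> (q (Suc n)) (- v) \<in> positive_roots" using stays_pos v by blast
    then have "\<rho> (q (Suc n)) v \<notin> positive_roots" using not_positive_neg by fastforce
    then show ?case by (simp add: p_Suc[of "Suc n"] inv_mult_group act_mult v_def)
  qed
  from this[of m] have "\<rho> (inv (p (Suc m))) a \<notin> positive_roots" by (simp add: m)
  then have "\<gamma> \<noteq> a" using r by (auto simp: \<gamma>_def \<beta>_def)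
  then show ?thesis using \<gamma> longer unfolding P_def by blast
qed

text \<open>
  As roots have norm one, a positive root is determined by the cone that it spans with
  \<open>\<alpha>\<^sub>s\<close>.
\<close>

lemma second_root_eqI:
  assumes s: "s \<in> S" and \<beta>: "\<beta> \<in> positive_roots" "\<beta> \<noteq> \<alpha> s"
    and plane: "\<And>c d. c *\<^sub>R \<alpha> s + d *\<^sub>R \<beta> \<in> positive_roots \<Longrightarrow> 0 \<le> c \<and> 0 \<le> d"
    and \<gamma>: "\<gamma> \<in> positive_roots" "\<gamma> \<noteq> \<alpha> s" "\<gamma> = c *\<^sub>R \<alpha> s + d *\<^sub>R \<beta>"
  shows "second_root G S \<rho> \<alpha> s \<gamma> = \<beta>"
proof -
  have a: "\<alpha> s \<in> positive_roots" using s simple_positive by blast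
  have "d \<noteq> 0" using \<gamma> a positive_proportional_eq by fastforce
  have plane_eq: "span {\<alpha> s, \<gamma>} \<inter> positive_roots = cone_of {\<alpha> s, \<beta>} \<inter> positive_roots"
  proof (intro equalityI subsetI IntI)
    fix v assume v: "v \<in> span {\<alpha> s, \<gamma>} \<inter> positive_roots"
    then obtain k where "v - k *\<^sub>R \<alpha> s \<in> span {\<gamma>}" by (auto simp: span_insert)
    then obtain l where "v - k *\<^sub>R \<alpha> s = l *\<^sub>R \<gamma>" by (auto simp: span_singleton)
    then have "v = (k + l * c) *\<^sub>R \<alpha> s + (l * d) *\<^sub>R \<beta>" by (simp add: \<gamma>(3) algebra_simps)
    then show "v \<in> cone_of {\<alpha> s, \<beta>}" using plane v unfolding cone_of_pair by blast
  next
    fix v assume v: "v \<in> cone_of {\<alpha> s, \<beta>} \<inter> positive_roots"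
    then obtain p q where "v = p *\<^sub>R \<alpha> s + q *\<^sub>R \<beta>" by (auto simp: cone_of_pair)
    moreover have "\<beta> = (1 / d) *\<^sub>R (\<gamma> - c *\<^sub>R \<alpha> s)" using \<open>d \<noteq> 0\<close> by (simp add: \<gamma>(3))
    then have "\<beta> \<in> span {\<alpha> s, \<gamma>}"
      by (metis insertCI span_base span_diff span_scale)
    ultimately show "v \<in> span {\<alpha> s, \<gamma>}" by (simp add: span_add span_scale span_base)
  qed auto
  show ?thesis unfolding second_root_def
  proof (rule the_equality)
    fix \<gamma>' assume *: "\<gamma>' \<in> positive_roots \<and>
      span {\<alpha> s, \<gamma>} \<inter> positive_roots = cone_of {\<alpha> s, \<gamma>'} \<inter> positive_roots"
    then have eq: "cone_of {\<alpha> s, \<beta>} \<inter> positive_roots = cone_of {\<alpha> s, \<gamma>'} \<inter> positive_roots"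
      using plane_eq by simp
    have "\<beta> \<in> cone_of {\<alpha> s, \<gamma>'}" "\<gamma>' \<in> cone_of {\<alpha> s, \<beta>}"
      using eq * \<beta> cone_of_incl[of \<beta> "{\<alpha> s, \<beta>}"] cone_of_incl[of \<gamma>' "{\<alpha> s, \<gamma>'}"] by auto
    then obtain p q p' q' where pq: "\<beta> = p *\<^sub>R \<alpha> s + q *\<^sub>R \<gamma>'" "0 \<le> p" "0 \<le> q"
      and pq': "\<gamma>' = p' *\<^sub>R \<alpha> s + q' *\<^sub>R \<beta>" "0 \<le> p'" "0 \<le> q'"
      unfolding cone_of_pair by blast
    have "\<beta> = p *\<^sub>R \<alpha> s + q *\<^sub>R (p' *\<^sub>R \<alpha> s + q' *\<^sub>R \<beta>)" using pq(1) pq'(1) by simp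
    then have comb: "(1 - q * q') *\<^sub>R \<beta> = (p + q * p') *\<^sub>R \<alpha> s" by (simp add: algebra_simps)
    have "1 - q * q' = 0"
    proof (rule ccontr)
      assume nz: "1 - q * q' \<noteq> 0"
      have "\<beta> = (1 / (1 - q * q')) *\<^sub>R ((1 - q * q') *\<^sub>R \<beta>)" using nz by simp
      also have "\<dots> = ((p + q * p') / (1 - q * q')) *\<^sub>R \<alpha> s" unfolding comb by simp
      finally show False using \<beta> a positive_proportional_eq by blast
    qed
    then have "p + q * p' = 0" using comb positive_nonzero[OF a] by simp
    then have "p = 0" using pq pq' by (metis add_nonneg_eq_0_iff mult_nonneg_nonneg)
    then show "\<gamma>' = \<beta>" using pq(1) * \<beta>(1) positive_proportional_eq[of \<beta> \<gamma>' q] by simp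
  qed (use plane_eq \<beta> in simp)
qed

text \<open>
  Assume that \<open>s \<beta>\<close> is not in the base of \<open>s y\<close>. Then \<open>s\<close> is a
  descent of \<open>s\<^sub>\<beta> y\<close>, which means that \<open>\<delta> = s\<^sub>\<beta>
  \<alpha>\<^sub>s\<close> is an inversion of \<open>y\<close>, and \<open>\<delta> = \<alpha>\<^sub>s +
  c \<beta>\<close> with \<open>c > 0\<close>. A positive root \<open>a \<alpha>\<^sub>s + b
  \<beta>\<close> with \<open>a < 0\<close> would be an inversion of \<open>y\<close> on the other side
  of \<open>\<beta>\<close>, contradicting that \<open>\<beta>\<close> is extreme. So
  \<open>\<alpha>\<^sub>s\<close> and \<open>\<beta>\<close> span the positive roots of their plane, and
  the last inversion of \<open>s y\<close> in this plane is the root whose image under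
  \<open>f\<^sub>s\<close> is \<open>\<beta>\<close>.
\<close>

theorem inv_base_descent:
  assumes s: "s \<in> S" and y: "y \<in> carrier G" and up: "len y < len (s \<otimes> y)"
  shows "inv_base G S \<rho> \<alpha> y \<subseteq> \<rho> s ` (inv_base G S \<rho> \<alpha> (s \<otimes> y) - {\<alpha> s})
    \<union> second_root G S \<rho> \<alpha> s ` (inv_base G S \<rho> \<alpha> (s \<otimes> y) - {\<alpha> s})"
proof
  fix \<beta> assume base: "\<beta> \<in> inv_base G S \<rho> \<alpha> y"
  define x where "x = s \<otimes> y"
  define u where "u = reflection \<beta> \<otimes> y"
  have x: "x \<in> carrier G" "s \<otimes> x = y" "len x = len y + 1"
    using s y up len_gen_mult[OF s y] by (auto simp: x_def)
  have \<beta>: "\<beta> \<in> inversions y" and len_u: "len u + 1 = len y"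
    using base mem_inv_base_iff[OF y] by (auto simp: u_def)
  note ext = mem_inv_base_imp_inversion(3)[OF y base]
  have \<beta>pos: "\<beta> \<in> positive_roots" and y\<beta>: "- \<rho> (inv y) \<beta> \<in> positive_roots"
    using \<beta> y by (auto simp: mem_inversions)
  then have \<beta>root: "\<beta> \<in> root_system" using positive_root by blast
  have \<alpha>pos: "\<alpha> s \<in> positive_roots" using s simple_positive by blast
  have \<alpha>_notin: "\<alpha> s \<notin> inversions y" using simple_not_inversion[OF y s] up by simp
  then have \<beta>\<alpha>: "\<beta> \<noteq> \<alpha> s" using \<beta> by blast
  have y\<alpha>: "\<rho> (inv y) (\<alpha> s) \<in> positive_roots" using \<alpha>_notin not_mem_inversions[OF y \<alpha>pos] by simp
  have u: "u \<in> carrier G" using y \<beta>root by (simp add: u_def)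
  have s\<beta>: "\<rho> s \<beta> \<in> inversions x"
    using inversions_gen_mult[OF y s up] \<beta> by (simp add: x_def)
  have \<alpha>x: "\<alpha> s \<in> inversions x" using inversions_gen_mult[OF y s up] by (simp add: x_def)
  have "\<beta> \<in> \<rho> s ` (inv_base G S \<rho> \<alpha> x - {\<alpha> s}) \<union> second_root G S \<rho> \<alpha> s ` (inv_base G S \<rho> \<alpha> x - {\<alpha> s})"
  proof (cases "len (s \<otimes> u) = len u + 1")
    case True
    have "reflection (\<rho> s \<beta>) \<otimes> x = s \<otimes> u"
      unfolding x_def u_def using reflection_conj_gen[OF s \<beta>root y] .
    then have "\<rho> s \<beta> \<in> inv_base G S \<rho> \<alpha> x"
      using s\<beta> True len_u x by (simp add: mem_inv_base_iff)
    moreover have "\<rho> s \<beta> \<noteq> \<alpha> s" using simple_root_not_image[OF s y] \<beta> by (metis imageI)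
    ultimately show ?thesis using s by (intro UnI1 image_eqI[of _ _ "\<rho> s \<beta>"]) auto
  next
    case False
    then have "\<alpha> s \<in> inversions u" using len_gen_mult[OF s u] simple_inversion[OF u s] by simp
    define c where "c = - 2 * B \<beta> (\<alpha> s)"
    define \<delta> where "\<delta> = \<alpha> s + c *\<^sub>R \<beta>"
    have \<delta>: "\<delta> = \<rho> (reflection \<beta>) (\<alpha> s)" using \<beta>root by (simp add: \<delta>_def c_def act_refl)
    have y\<delta>: "- \<rho> (inv y) \<delta> \<in> positive_roots"
      using \<open>\<alpha> s \<in> inversions u\<close> u y \<beta>root by (simp add: mem_inversions \<delta> u_def inv_mult_group act_mult)
    have "0 < c"
    proof (rule ccontr)
      assume "\<not> 0 < c"
      then have "(- c) *\<^sub>R (- \<rho> (inv y) \<beta>) \<in> simple_cone"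
        using y\<beta> by (intro cone_of_scale) (auto simp: positive_cone)
      moreover have "\<rho> (inv y) (\<alpha> s) + (- c) *\<^sub>R (- \<rho> (inv y) \<beta>) + (- \<rho> (inv y) \<delta>) = 0"
        using y by (simp add: \<delta>_def)
      ultimately have "\<rho> (inv y) (\<alpha> s) = 0"
        using simple_cone_salient3(1) y\<alpha> y\<delta> positive_cone by blast
      then show False using y\<alpha> positive_nonzero by blast
    qed
    have "\<delta> \<in> simple_cone"
      using \<open>0 < c\<close> \<alpha>pos \<beta>pos unfolding \<delta>_def by (intro cone_of_add cone_of_scale) (auto simp: positive_cone)
    moreover have "\<delta> \<in> root_system" using \<beta>root \<alpha>pos by (simp add: \<delta> root_act positive_root)
    ultimately have \<delta>inv: "\<delta> \<in> inversions y" using y y\<delta> by (simp add: mem_inversions positiveI)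

    have plane: "0 \<le> a \<and> 0 \<le> b" if \<epsilon>: "a *\<^sub>R \<alpha> s + b *\<^sub>R \<beta> \<in> positive_roots" (is "?\<epsilon> \<in> _") for a b
    proof (rule ccontr)
      assume neg: "\<not> (0 \<le> a \<and> 0 \<le> b)"
      consider "b < 0" | "a < 0" "0 \<le> b" using neg by linarith
      then show False
      proof cases
        case 1
        have "(- b) *\<^sub>R \<beta> + ?\<epsilon> = a *\<^sub>R \<alpha> s" by simp
        moreover have "(- b) *\<^sub>R \<beta> \<in> simple_cone"
          using 1 \<beta>pos by (intro cone_of_scale) (auto simp: positive_cone)
        ultimately obtain e where e: "(- b) *\<^sub>R \<beta> = e *\<^sub>R \<alpha> s"
          using simple_root_extreme[OF s] \<epsilon> positive_cone by blast
        have "\<beta> = (1 / (- b)) *\<^sub>R ((- b) *\<^sub>R \<beta>)" using 1 by simp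
        also have "\<dots> = (e / (- b)) *\<^sub>R \<alpha> s" unfolding e by simp
        finally have "\<beta> = (e / (- b)) *\<^sub>R \<alpha> s" .
        then show False using positive_proportional_eq[OF \<beta>pos \<alpha>pos] \<beta>\<alpha> by blast
      next
        case 2
        have "- \<rho> (inv y) ?\<epsilon> = (- a) *\<^sub>R \<rho> (inv y) (\<alpha> s) + b *\<^sub>R (- \<rho> (inv y) \<beta>)"
          using y by simp
        also have "\<dots> \<in> simple_cone"
          using 2 y\<alpha> y\<beta> by (intro cone_of_add cone_of_scale) (auto simp: positive_cone)
        finally have "- \<rho> (inv y) ?\<epsilon> \<in> positive_roots"
          using \<epsilon> y by (meson inv_closed positiveI positive_root root_act root_neg)
        then have \<epsilon>inv: "?\<epsilon> \<in> inversions y" using \<epsilon> y by (simp add: mem_inversions)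
        have sum: "(- a) *\<^sub>R \<delta> + ?\<epsilon> = (b - a * c) *\<^sub>R \<beta>" by (simp add: \<delta>_def algebra_simps)
        have "a * c < 0" using 2 \<open>0 < c\<close> by (simp add: mult_neg_pos)
        then have pos: "0 < b - a * c" using 2 by linarith
        have "open_ray \<beta> \<subseteq> cone_of {\<delta>, ?\<epsilon>}"
        proof
          fix v assume "v \<in> open_ray \<beta>"
          then obtain k where k: "0 < k" "v = k *\<^sub>R \<beta>" by (auto simp: open_ray_def)
          have "v = (k / (b - a * c)) *\<^sub>R ((b - a * c) *\<^sub>R \<beta>)" using k pos by simp
          also have "\<dots> = (k / (b - a * c)) *\<^sub>R ((- a) *\<^sub>R \<delta> + ?\<epsilon>)" by (simp only: sum)
          also have "\<dots> \<in> cone_of {\<delta>, ?\<epsilon>}"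
            using k pos 2 by (intro cone_of_scale cone_of_add cone_of_incl) auto
          finally show "v \<in> cone_of {\<delta>, ?\<epsilon>}" .
        qed
        then have "\<delta> \<in> open_ray \<beta> \<or> ?\<epsilon> \<in> open_ray \<beta>"
          using ext \<delta>inv \<epsilon>inv unfolding extreme_ray_def by (meson cone_of_incl)
        then obtain k where "\<delta> = k *\<^sub>R \<beta> \<or> ?\<epsilon> = k *\<^sub>R \<beta>" by (auto simp: open_ray_def)
        then have "\<alpha> s = (k - c) *\<^sub>R \<beta> \<or> a *\<^sub>R \<alpha> s = (k - b) *\<^sub>R \<beta>"
          by (auto simp: \<delta>_def algebra_simps)
        then have "\<exists>l. \<alpha> s = l *\<^sub>R \<beta>"
        proof
          assume eq: "a *\<^sub>R \<alpha> s = (k - b) *\<^sub>R \<beta>"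
          have "\<alpha> s = (1 / a) *\<^sub>R (a *\<^sub>R \<alpha> s)" using 2 by simp
          also have "\<dots> = ((k - b) / a) *\<^sub>R \<beta>" unfolding eq by simp
          finally show ?thesis by blast
        qed blast
        then show False using positive_proportional_eq[OF \<alpha>pos \<beta>pos] \<beta>\<alpha> by blast
      qed
    qed

    obtain \<gamma> a b where \<gamma>: "\<gamma> \<in> inversions x" "\<gamma> \<noteq> \<alpha> s" "\<gamma> = a *\<^sub>R \<alpha> s + b *\<^sub>R \<beta>"
      and long: "len (reflection \<beta> \<otimes> (reflection (\<alpha> s) \<otimes> x)) < len (reflection \<gamma> \<otimes> x)"
      using dihedral_last_inversion_long[OF x(1) \<alpha>pos \<beta>pos plane \<alpha>x] s\<beta> refl_simple[OF s] by auto
    have "len u < len (reflection \<gamma> \<otimes> x)" using long s x(2) by (simp add: refl_simple u_def)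
    moreover have "len (reflection \<gamma> \<otimes> x) < len x" using len_reflection_less[OF x(1) \<gamma>(1)] .
    ultimately have "len (reflection \<gamma> \<otimes> x) + 1 = len x" using len_u x(3) by linarith
    then have "\<gamma> \<in> inv_base G S \<rho> \<alpha> x" using \<gamma>(1) x(1) by (simp add: mem_inv_base_iff)
    moreover have "second_root G S \<rho> \<alpha> s \<gamma> = \<beta>"
      using \<gamma> x(1) by (intro second_root_eqI[OF s \<beta>pos \<beta>\<alpha> plane]) (auto simp: mem_inversions)
    ultimately show ?thesis using \<gamma>(2) by (intro UnI2 image_eqI[of _ _ \<gamma>]) auto
  qed
  then show "\<beta> \<in> \<rho> s ` (inv_base G S \<rho> \<alpha> (s \<otimes> y) - {\<alpha> s})
    \<union> second_root G S \<rho> \<alpha> s ` (inv_base G S \<rho> \<alpha> (s \<otimes> y) - {\<alpha> s})" by (simp only: x_def)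
qed

end

theorem theorem4p10:
  fixes G :: "('w, 'm) monoid_scheme"
    and S :: "'w set"
    and \<rho> :: "'w \<Rightarrow> 'v::real_vector \<Rightarrow> 'v"
    and B :: "'v \<Rightarrow> 'v \<Rightarrow> real"
    and \<alpha> :: "'w \<Rightarrow> 'v"
    and s x :: 'w
  assumes "geometric_representation G S \<rho> B \<alpha>"
    and "s \<in> S"
    and "x \<in> carrier G"
  shows
    "(bruhat_cover G S \<rho> B \<alpha> (s \<otimes>\<^bsub>G\<^esub> x) x \<longrightarrow>
        inv_base G S \<rho> \<alpha> (s \<otimes>\<^bsub>G\<^esub> x)
          \<subseteq> \<rho> s ` (inv_base G S \<rho> \<alpha> x - {\<alpha> s})
             \<union> second_root G S \<rho> \<alpha> s ` (inv_base G S \<rho> \<alpha> x - {\<alpha> s})) \<and>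
     (bruhat_cover G S \<rho> B \<alpha> x (s \<otimes>\<^bsub>G\<^esub> x) \<longrightarrow>
        inv_base G S \<rho> \<alpha> (s \<otimes>\<^bsub>G\<^esub> x)
          = {\<alpha> s} \<union> \<rho> s ` {\<beta> \<in> inv_base G S \<rho> \<alpha> x.
              bruhat_less G S \<rho> B \<alpha> (refl_elt G \<rho> B \<beta> \<otimes>\<^bsub>G\<^esub> x)
                (s \<otimes>\<^bsub>G\<^esub> (refl_elt G \<rho> B \<beta> \<otimes>\<^bsub>G\<^esub> x))} \<and>
        {\<alpha> s} \<inter> \<rho> s ` {\<beta> \<in> inv_base G S \<rho> \<alpha> x.
              bruhat_less G S \<rho> B \<alpha> (refl_elt G \<rho> B \<beta> \<otimes>\<^bsub>G\<^esub> x)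
                (s \<otimes>\<^bsub>G\<^esub> (refl_elt G \<rho> B \<beta> \<otimes>\<^bsub>G\<^esub> x))} = {})"
proof -
  interpret geometric_representation G S \<rho> B \<alpha> by fact
  note s = \<open>s \<in> S\<close> and x = \<open>x \<in> carrier G\<close>
  have sub: "inv_base G S \<rho> \<alpha> x \<subseteq> inversions x" using x by (auto simp: mem_inv_base_iff)
  have "reflection \<beta> \<otimes>\<^bsub>G\<^esub> x \<in> carrier G" if "\<beta> \<in> inv_base G S \<rho> \<alpha> x" for \<beta>
    using that sub x by (auto simp: mem_inversions positive_root)
  then have less_iff: "{\<beta> \<in> inv_base G S \<rho> \<alpha> x.
        bruhat_less G S \<rho> B \<alpha> (reflection \<beta> \<otimes>\<^bsub>G\<^esub> x) (s \<otimes>\<^bsub>G\<^esub> (reflection \<beta> \<otimes>\<^bsub>G\<^esub> x))} =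
      {\<beta> \<in> inv_base G S \<rho> \<alpha> x. len (reflection \<beta> \<otimes>\<^bsub>G\<^esub> x) < len (s \<otimes>\<^bsub>G\<^esub> (reflection \<beta> \<otimes>\<^bsub>G\<^esub> x))}"
    using s bruhat_less_gen_mult by blast
  show ?thesis
  proof (intro conjI impI)
    assume "bruhat_cover G S \<rho> B \<alpha> (s \<otimes>\<^bsub>G\<^esub> x) x"
    then have "len (s \<otimes>\<^bsub>G\<^esub> x) < len x" by (simp add: bruhat_cover_def)
    then show "inv_base G S \<rho> \<alpha> (s \<otimes>\<^bsub>G\<^esub> x) \<subseteq> \<rho> s ` (inv_base G S \<rho> \<alpha> x - {\<alpha> s})
        \<union> second_root G S \<rho> \<alpha> s ` (inv_base G S \<rho> \<alpha> x - {\<alpha> s})"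
      using inv_base_descent[of s "s \<otimes>\<^bsub>G\<^esub> x"] s x by simp
  next
    assume "bruhat_cover G S \<rho> B \<alpha> x (s \<otimes>\<^bsub>G\<^esub> x)"
    then have "len x < len (s \<otimes>\<^bsub>G\<^esub> x)" by (simp add: bruhat_cover_def)
    then show "inv_base G S \<rho> \<alpha> (s \<otimes>\<^bsub>G\<^esub> x) = {\<alpha> s} \<union> \<rho> s ` {\<beta> \<in> inv_base G S \<rho> \<alpha> x.
        bruhat_less G S \<rho> B \<alpha> (reflection \<beta> \<otimes>\<^bsub>G\<^esub> x) (s \<otimes>\<^bsub>G\<^esub> (reflection \<beta> \<otimes>\<^bsub>G\<^esub> x))}"
      unfolding less_iff using inv_base_ascent s x by simp
  next
    show "{\<alpha> s} \<inter> \<rho> s ` {\<beta> \<in> inv_base G S \<rho> \<alpha> x.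
        bruhat_less G S \<rho> B \<alpha> (reflection \<beta> \<otimes>\<^bsub>G\<^esub> x) (s \<otimes>\<^bsub>G\<^esub> (reflection \<beta> \<otimes>\<^bsub>G\<^esub> x))} = {}"
      using simple_root_not_image[OF s x] sub by blast
  qed
qed

end
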